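(* Let $p>m\geq n>q\geq 0$ be integers satisfying $m+n=p+q$, let $c>0$ be a real number, and let $s$ denote a real number. With $F_{p,m,n,q}(x;s;c)$, $\alpha_{p,m,n,q}$ and $\beta_{p,m,n,q}$ as defined in the context, the following hold. (1) Suppose $0<c\leq 1$. (a) The function $x\mapsto F_{p,m,n,q}(x;s;c)$ is completely monotonic on $(0,+\infty)$ if and only if $s\leq \alpha_{p,m,n,q}$. (b) The function $x\mapsto -F_{m+n,m,n,0}(x;s;c)$ is completely monotonic on $(0,+\infty)$ if and only if $s\geq \alpha_{m+n,m,n,0}/c$. (2) Suppose $c\geq 1$. (a) The function $x\mapsto -F_{p,m,n,q}(x;s;c)$ is completely monotonic on $(0,+\infty)$ if and only if $s\geq \alpha_{p,m,n,q}$. (b) The function $x\mapsto F_{m+n,m,n,0}(x;s;c)$ is completely monotonic on $(0,+\infty)$ if and only if $s\leq \alpha_{m+n,m,n,0}/c$. (3) If $q\geq 1$, then the function $x\mapsto -F_{p,m,n,q}(x;\beta_{p,m,n,q};c)$ is completely monotonic on $(0,+\infty)$ for all $c>0$.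
   Context: A function $f$ is completely monotonic on $(a,b)$ if it has derivatives of all orders there and $(-1)^k f^{(k)}(x)\geq 0$ for all $x\in(a,b)$ and all integers $k\geq 0$. For $x>0$, $\psi(x)=\Gamma'(x)/\Gamma(x)$ is the digamma function, where $\Gamma(x)=\int_0^\infty t^{x-1}e^{-t}\,dt$; for $k\geq 1$, $\psi^{(k)}$ is its $k$-th derivative. By convention $\psi^{(0)}(x)=\psi(x)$ and $\psi^{(-1)}(x)=-x$. For a function $f$ and $c>0$, put $$\Delta f(x;c)=\frac{f(x+c)-f(x)}{c}.$$ (In particular $\Delta\psi^{(-1)}(x;c)=-1$.) For integers $p\geq m\geq n\geq q\geq 0$, with $m,n,p\ge 1$, real $c>0$ and real $s$, define for $x>0$ $$F_{p,m,n,q}(x;s;c)=(-1)^{m+n}\,\Delta\psi^{(m-1)}(x;c)\,\Delta\psi^{(n-1)}(x;c)-s\,(-1)^{p+q}\,\Delta\psi^{(p-1)}(x;c)\,\Delta\psi^{(q-1)}(x;c).$$ The constants are $$\alpha_{p,m,n,q}=\frac{(m-1)!\,(n-1)!}{(p-1)!\,(q-1)!}\ \text{ if } q\geq 1,\qquad \alpha_{p,m,n,0}=\frac{(m-1)!\,(n-1)!}{(p-1)!},\qquad \beta_{p,m,n,q}=\frac{m!\,n!}{p!\,q!}.$$ *)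

theory Defs
  imports "HOL-Analysis.Analysis"
begin

text \<open>
  Intended for open \<open>S\<close>: there \<^term>\<open>(deriv ^^ k) f\<close> agrees on \<open>S\<close> with the classical \<open>k\<close>-th
  derivative of \<open>f\<close> as soon as the lower ones are differentiable, so the first conjunct says that
  \<open>f\<close> has derivatives of all orders on \<open>S\<close>.
\<close>
definition completely_monotonic_on :: "real set \<Rightarrow> (real \<Rightarrow> real) \<Rightarrow> bool" where
  "completely_monotonic_on S f \<longleftrightarrow>
     (\<forall>k. \<forall>x\<in>S. (deriv ^^ k) f field_differentiable (at x)) \<and>
     (\<forall>k. \<forall>x\<in>S. (-1) ^ k * (deriv ^^ k) f x \<ge> 0)"

text \<open>
  The index is shifted by one: \<open>psi_pred k\<close> is \<open>\<psi>\<^sup>(\<^sup>k\<^sup>-\<^sup>1\<^sup>)\<close>, so that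
  \<open>psi_pred 0\<close> is the conventional \<open>\<psi>\<^sup>(\<^sup>-\<^sup>1\<^sup>)(x) = -x\<close>.
\<close>
fun psi_pred :: "nat \<Rightarrow> real \<Rightarrow> real" where
  "psi_pred 0 x = - x"
| "psi_pred (Suc k) x = Polygamma k x"

text \<open>
  The library introduces \<^const>\<open>Polygamma\<close> by series; these two facts identify
  \<^term>\<open>psi_pred (Suc k)\<close> with the \<open>k\<close>-th derivative of \<open>\<Gamma>' / \<Gamma>\<close> on the positive reals.
\<close>
lemma psi_pred_1_eq:
  assumes "x > 0"
  shows "psi_pred 1 x = deriv Gamma x / Gamma x"
proof -
  have x: "x \<notin> \<int>\<^sub>\<le>\<^sub>0"
    using assms by (auto elim!: nonpos_Ints_cases)
  have "deriv Gamma x = Gamma x * Digamma x"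
    by (rule DERIV_imp_deriv, rule has_field_derivative_Gamma, rule x)
  moreover have "Gamma x \<noteq> 0"
    using Gamma_real_pos[OF assms] by simp
  ultimately show ?thesis
    by simp
qed

lemma psi_pred_Suc_eq:
  assumes "x > 0"
  shows "psi_pred (Suc k) x = (deriv ^^ k) (\<lambda>y. deriv Gamma y / Gamma y) x"
proof -
  have x: "x \<notin> \<int>\<^sub>\<le>\<^sub>0"
    using assms by (auto elim!: nonpos_Ints_cases)
  have "eventually (\<lambda>y. y \<in> {0<..}) (nhds x)"
    using assms by (intro eventually_nhds_in_open) auto
  hence "eventually (\<lambda>y. Digamma y = deriv Gamma y / Gamma y) (nhds x)"
    by eventually_elim (use psi_pred_1_eq in auto)
  hence "(deriv ^^ k) Digamma x = (deriv ^^ k) (\<lambda>y. deriv Gamma y / Gamma y) x"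
    by (rule higher_deriv_cong_ev) simp
  thus ?thesis
    using higher_deriv_Polygamma[OF x, of k 0] by simp
qed

definition Delta :: "(real \<Rightarrow> real) \<Rightarrow> real \<Rightarrow> real \<Rightarrow> real" where
  "Delta f x c = (f (x + c) - f x) / c"

definition F :: "nat \<Rightarrow> nat \<Rightarrow> nat \<Rightarrow> nat \<Rightarrow> real \<Rightarrow> real \<Rightarrow> real \<Rightarrow> real" where
  "F p m n q x s c =
     (-1) ^ (m + n) * Delta (psi_pred m) x c * Delta (psi_pred n) x c
     - s * (-1) ^ (p + q) * Delta (psi_pred p) x c * Delta (psi_pred q) x c"

definition alpha :: "nat \<Rightarrow> nat \<Rightarrow> nat \<Rightarrow> nat \<Rightarrow> real" where
  "alpha p m n q =
     (if q = 0 then fact (m - 1) * fact (n - 1) / fact (p - 1)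
      else fact (m - 1) * fact (n - 1) / (fact (p - 1) * fact (q - 1)))"

definition beta :: "nat \<Rightarrow> nat \<Rightarrow> nat \<Rightarrow> nat \<Rightarrow> real" where
  "beta p m n q = fact m * fact n / (fact p * fact q)"

end

theory Submission
  imports Defs "HOL-Probability.Distributions" "HOL-Real_Asymp.Real_Asymp"
begin

text \<open>
  Put $f_m = (-1)^{m+1} \Delta\psi^{(m-1)}(\cdot; c)$. For $m \geq 1$ this is the Laplace transform of
  $t^{m-1} g(t)$ with $g(t) = (1 - e^{-ct}) / (c (1 - e^{-t}))$, and $f_0 = 1$. Hence
  $F = f_m f_n - s f_p f_q$ is the Laplace transform of a difference of convolutions, and it is
  completely monotonic as soon as that difference is nonnegative at every $t > 0$.
  After symmetrisation in $u \leftrightarrow t - u$, the quotient of the weights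
  $u^{m-1} (t-u)^{n-1}$ and $u^{p-1} (t-u)^{q-1}$ increases with $u (t-u)$. The factor
  $g(u) g(t-u)$ also increases with $u (t-u)$ when $g$ is log-concave ($c \leq 1$) and decreases when $g$ is
  log-convex ($c \geq 1$). Chebyshev's inequality compares the two convolutions with the quotient of
  two Beta integrals, which is $\alpha$. For (3) the same argument is applied to $g(t) / t$,
  which is log-convex for every $c > 0$. For $q = 0$ the bounds needed are
  $g(t) \leq g(u) g(t-u) \leq g(t) / c$ for $c \leq 1$ and the reversed ones for $c \geq 1$. Necessity is read off from
  $x^m f_m(x) \to (m-1)!$ as $x \to \infty$ and, for $m \ge 1$, $x^m f_m(x) \to (m-1)!/c$ as $x \to 0$.
\<close>

subsection \<open>Laplace representation of the differences of polygamma functions\<close>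

text \<open>The constants reflect the two ends of the kernel: \<open>g\<close> tends to 1 at
  \<open>0+\<close> and to \<open>1 / c\<close> at infinity. Large \<open>x\<close> sees the first
  value. For a constant kernel Chebyshev's inequality is an equality between Beta integrals, which
  is why \<alpha> is sharp. Small \<open>x\<close> sees the second value: each \<open>f_m\<close>
  with \<open>m \<ge> 1\<close> contributes a factor \<open>1 / c\<close> while
  \<open>f_0 = 1\<close> does not, so for \<open>q = 0\<close> one factor \<open>1 / c\<close>
  survives. The change at \<open>c = 1\<close> comes from \<open>(ln g)'' = h_1 - h_c\<close> with
  \<open>h_c = (c / (2 * sinh (c * t / 2)))^2\<close>, which decreases in \<open>c\<close>. Moreover
  \<open>h_c\<close> is at most \<open>1 / t^2\<close>, so division of \<open>g\<close> by
  \<open>t\<close> gives log-convexity for every \<open>c\<close>. This division raises all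
  exponents by one, turning \<open>(m-1)!\<close> into \<open>m!\<close> and \<alpha> into \<beta>.
  Differences of kernels are never formed: two nonnegative kernels are compared pointwise, so all
  integrals stay in \<open>ennreal\<close>, where Tonelli and termwise summation need no
  integrability. Likewise no derivative is taken under an integral: differentiating
  \<open>f_m\<close> only raises \<open>m\<close>, which on the kernel side is multiplication by
  \<open>t\<close>.\<close>

definition delta_psi :: "real \<Rightarrow> nat \<Rightarrow> real \<Rightarrow> real" where
  "delta_psi c m x = (-1) ^ Suc m * Delta (psi_pred m) x c"

lemma delta_psi_0: "c > 0 \<Longrightarrow> delta_psi c 0 x = 1"
  by (simp add: delta_psi_def Delta_def)

lemma F_eq_delta_psi: "F p m n q x s c = delta_psi c m x * delta_psi c n x - s * (delta_psi c p x * delta_psi c q x)"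
  by (simp add: F_def delta_psi_def power_add)

lemma pos_notin_nonpos_Ints: "x \<notin> \<int>\<^sub>\<le>\<^sub>0" if "x > 0" for x :: real
  using that by (auto elim!: nonpos_Ints_cases)

text \<open>The sign in \<open>delta_psi\<close> is chosen for this: differentiation raises the
  index and changes the sign, so the functions of higher index are themselves the signed
  derivatives.\<close>

lemma delta_psi_Suc_has_derivative:
  assumes "c > 0" "x > 0"
  shows "(delta_psi c (Suc m) has_real_derivative - delta_psi c (Suc (Suc m)) x) (at x)"
proof -
  have "x + c \<notin> \<int>\<^sub>\<le>\<^sub>0" "x \<notin> \<int>\<^sub>\<le>\<^sub>0"
    using assms by (auto intro!: pos_notin_nonpos_Ints)
  thus ?thesis
    unfolding delta_psi_def Delta_def psi_pred.simps
    using assms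
    by (intro DERIV_cong[OF DERIV_cmult[OF DERIV_cdivide[OF DERIV_diff[OF
          DERIV_shift[THEN iffD1, OF has_field_derivative_Polygamma] has_field_derivative_Polygamma]]]])
       (auto simp: field_simps)
qed

text \<open>For \<open>m = 0\<close> the digamma series converges only with the regularising terms
  \<open>1 / (k + 1)\<close>. These terms and the Euler constant cancel in the difference, so both
  cases end in the same series.\<close>

lemma delta_psi_Suc_sums:
  assumes "c > 0" "x > 0"
  shows "(\<lambda>k. fact m / c * (1 / (x + real k) ^ Suc m - 1 / (x + c + real k) ^ Suc m))
           sums delta_psi c (Suc m) x"
proof (cases "m = 0")
  case True
  have S: "(\<lambda>k. inverse (of_nat (Suc k)) - inverse (y + of_nat k)) sums (Digamma y + euler_mascheroni)"
    if "y > 0" for y :: real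
    using summable_Digamma[of y] that by (simp add: Digamma_def summable_sums)
  have "(\<lambda>k. 1 / c * ((inverse (of_nat (Suc k)) - inverse ((x + c) + of_nat k)) -
           (inverse (of_nat (Suc k)) - inverse (x + of_nat k)))) sums
         (1 / c * ((Digamma (x + c) + euler_mascheroni) - (Digamma x + euler_mascheroni)))"
    using assms by (intro sums_mult sums_diff S) auto
  thus ?thesis
    using True by (simp add: delta_psi_def Delta_def inverse_eq_divide)
next
  case False
  have S: "(\<lambda>k. inverse ((y + of_nat k) ^ Suc m)) sums ((-1) ^ Suc m * Polygamma m y / fact m)"
    if "y > 0" for y :: real
    using Polygamma_LIMSEQ[of y m] that False by simp
  have "(\<lambda>k. fact m / c * (inverse ((x + of_nat k) ^ Suc m) - inverse (((x + c) + of_nat k) ^ Suc m)))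
         sums (fact m / c * ((-1) ^ Suc m * Polygamma m x / fact m - (-1) ^ Suc m * Polygamma m (x + c) / fact m))"
    using assms by (intro sums_mult sums_diff S) auto
  also have "fact m / c * ((-1) ^ Suc m * Polygamma m x / fact m - (-1) ^ Suc m * Polygamma m (x + c) / fact m)
     = delta_psi c (Suc m) x"
    using assms by (simp add: delta_psi_def Delta_def field_simps)
  finally show ?thesis by (simp add: inverse_eq_divide)
qed

lemma nn_integral_power_exp:
  assumes "y > 0"
  shows "(\<integral>\<^sup>+t\<in>{0<..}. ennreal (t ^ k * exp (- y * t)) \<partial>lborel) = ennreal (fact k / y ^ Suc k)"
proof -
  have "ennreal (fact k) = (\<integral>\<^sup>+t. ennreal (t ^ k * exp (- t)) * indicator {0..} t \<partial>lborel)"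
    by (simp add: nn_intergal_power_times_exp_Ici)
  also have "\<dots> = (\<integral>\<^sup>+t. ennreal (t ^ k * exp (- t)) * indicator {0<..} t \<partial>lborel)"
    by (intro nn_integral_cong_AE AE_I[where N="{0}"]) (auto simp: indicator_def)
  also have "\<dots> = ennreal y * (\<integral>\<^sup>+t. ennreal ((0 + y * t) ^ k * exp (- (0 + y * t))) * indicator {0<..} (0 + y * t) \<partial>lborel)"
    using assms by (subst nn_integral_real_affine[where c=y and t=0]) auto
  also have "\<dots> = ennreal y * (\<integral>\<^sup>+t. ennreal (y ^ k) * (ennreal (t ^ k * exp (- y * t)) * indicator {0<..} t) \<partial>lborel)"
  proof -
    have "ennreal ((0 + y * t) ^ k * exp (- (0 + y * t))) * indicator {0<..} (0 + y * t) =
        ennreal (y ^ k) * (ennreal (t ^ k * exp (- y * t)) * indicator {0<..} t)" for t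
    proof (cases "t > 0")
      case True
      thus ?thesis using assms by (simp add: ennreal_mult'[symmetric] power_mult_distrib mult_ac)
    next
      case False
      thus ?thesis using assms by (simp add: zero_less_mult_iff)
    qed
    thus ?thesis by (simp only:)
  qed
  also have "\<dots> = ennreal (y ^ Suc k) * (\<integral>\<^sup>+t\<in>{0<..}. ennreal (t ^ k * exp (- y * t)) \<partial>lborel)"
    using assms by (subst nn_integral_cmult) (auto simp: ennreal_mult mult_ac)
  finally have *: "ennreal (fact k) = ennreal (y ^ Suc k) * (\<integral>\<^sup>+t\<in>{0<..}. ennreal (t ^ k * exp (- y * t)) \<partial>lborel)" .
  have "ennreal (fact k / y ^ Suc k) = ennreal (1 / y ^ Suc k) * ennreal (fact k)"
    using assms by (simp add: ennreal_mult'[symmetric])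
  also have "\<dots> = (ennreal (1 / y ^ Suc k) * ennreal (y ^ Suc k)) * (\<integral>\<^sup>+t\<in>{0<..}. ennreal (t ^ k * exp (- y * t)) \<partial>lborel)"
    by (simp only: * mult.assoc)
  also have "ennreal (1 / y ^ Suc k) * ennreal (y ^ Suc k) = 1"
    using assms by (subst ennreal_mult'[symmetric]) auto
  finally show ?thesis by simp
qed

text \<open>Origin of the formula: \<open>exp (- x * t) - exp (- (x + c) * t)\<close> supplies the
  numerator, and the geometric series over the shifts \<open>x + k\<close> supplies
  \<open>1 / (1 - exp (- t))\<close>.\<close>

definition delta_kernel :: "real \<Rightarrow> real \<Rightarrow> real" where
  "delta_kernel c t = (1 - exp (- c * t)) / (c * (1 - exp (- t)))"

lemma delta_kernel_pos: "c > 0 \<Longrightarrow> t > 0 \<Longrightarrow> delta_kernel c t > 0"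
  by (simp add: delta_kernel_def)

lemma delta_kernel_measurable [measurable]: "delta_kernel c \<in> borel_measurable borel"
  unfolding delta_kernel_def by measurable

lemma delta_psi_Suc_summand_nonneg:
  assumes "c > 0" "x > 0"
  shows "fact m / c * (1 / (x + real k) ^ Suc m - 1 / (x + c + real k) ^ Suc m) \<ge> 0"
proof -
  have "(x + real k) ^ Suc m \<le> (x + c + real k) ^ Suc m"
    using assms by (intro power_mono) auto
  thus ?thesis
    using assms by (intro mult_nonneg_nonneg) (auto intro!: divide_left_mono mult_pos_pos simp del: power_Suc)
qed

lemma delta_psi_Suc_nonneg:
  assumes "c > 0" "x > 0"
  shows "delta_psi c (Suc m) x \<ge> 0"
  by (rule sums_le[OF delta_psi_Suc_summand_nonneg sums_zero delta_psi_Suc_sums]) (use assms in auto)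

text \<open>Each term of the series is the Laplace integral of \<open>h k\<close>. Since every
  \<open>h k\<close> is nonnegative, sum and integral may be exchanged, and the sum of the
  \<open>h k\<close> is geometric in \<open>exp (- t)\<close>.\<close>

lemma delta_psi_Suc_integral:
  assumes c: "c > 0" and x: "x > 0"
  shows "ennreal (delta_psi c (Suc m) x) =
           (\<integral>\<^sup>+t\<in>{0<..}. ennreal (t ^ m * delta_kernel c t * exp (- x * t)) \<partial>lborel)"
proof -
  define a where "a k = fact m / c * (1 / (x + real k) ^ Suc m - 1 / (x + c + real k) ^ Suc m)" for k
  define h where "h k t = t ^ m * (exp (- (x + real k) * t) - exp (- (x + c + real k) * t)) / c" for k t
  have h_nonneg: "h k t \<ge> 0" if "t > 0" for k t
    using that c unfolding h_def by (intro divide_nonneg_pos mult_nonneg_nonneg) (auto simp: algebra_simps)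
  have h_int: "(\<integral>\<^sup>+t\<in>{0<..}. ennreal (h k t) \<partial>lborel) = ennreal (a k)" for k
  proof -
    define I where "I y = (\<integral>\<^sup>+t\<in>{0<..}. ennreal (t ^ m * exp (- y * t)) \<partial>lborel)" for y
    have I: "I y = ennreal (fact m / y ^ Suc m)" if "y > 0" for y
      unfolding I_def by (rule nn_integral_power_exp[OF that])
    \<comment> \<open>The integral for \<open>x + k\<close> is split as that of \<open>h k\<close>
      plus that for \<open>x + c + k\<close>; only then is the latter, which is finite, subtracted.
      This avoids integrating a difference in \<open>ennreal\<close>.\<close>
    have "ennreal (1/c) * I (x + k) =
      (\<integral>\<^sup>+t. ennreal (1/c) * (ennreal (t ^ m * exp (- (x + k) * t)) * indicator {0<..} t) \<partial>lborel)"
      unfolding I_def by (subst nn_integral_cmult) auto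
    also have "\<dots> = (\<integral>\<^sup>+t. ennreal (h k t) * indicator {0<..} t
           + ennreal (1/c) * (ennreal (t ^ m * exp (- (x + c + k) * t)) * indicator {0<..} t) \<partial>lborel)"
    proof (intro nn_integral_cong)
      fix t :: real
      show "ennreal (1/c) * (ennreal (t ^ m * exp (- (x + k) * t)) * indicator {0<..} t) =
         ennreal (h k t) * indicator {0<..} t
           + ennreal (1/c) * (ennreal (t ^ m * exp (- (x + c + k) * t)) * indicator {0<..} t)"
      proof (cases "t > 0")
        case True
        thus ?thesis using c h_nonneg[OF True, of k]
          by (simp add: ennreal_mult'[symmetric] ennreal_plus[symmetric] del: ennreal_plus)
             (simp add: h_def field_simps)
      qed auto
    qed
    also have "\<dots> = (\<integral>\<^sup>+t\<in>{0<..}. ennreal (h k t) \<partial>lborel) + ennreal (1/c) * I (x + c + k)"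
      unfolding I_def by (subst nn_integral_add) (auto simp: nn_integral_cmult h_def)
    finally have "ennreal (1/c) * I (x + k) = (\<integral>\<^sup>+t\<in>{0<..}. ennreal (h k t) \<partial>lborel) + ennreal (1/c) * I (x + c + k)" .
    hence "(\<integral>\<^sup>+t\<in>{0<..}. ennreal (h k t) \<partial>lborel) = ennreal (1/c) * I (x + k) - ennreal (1/c) * I (x + c + k)"
      using c x by (simp add: I ennreal_mult'[symmetric] del: power_Suc)
    also have "\<dots> = ennreal (1/c * (fact m / (x + k) ^ Suc m) - 1/c * (fact m / (x + c + k) ^ Suc m))"
      using c x by (simp add: I ennreal_mult'[symmetric] ennreal_minus del: power_Suc)
    also have "1/c * (fact m / (x + k) ^ Suc m) - 1/c * (fact m / (x + c + k) ^ Suc m) = a k"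
      by (simp add: a_def algebra_simps diff_divide_distrib)
    finally show ?thesis .
  qed
  have a_nonneg: "a k \<ge> 0" for k
    unfolding a_def by (rule delta_psi_Suc_summand_nonneg[OF c x])
  have h_sums: "(\<lambda>k. h k t) sums (t ^ m * delta_kernel c t * exp (- x * t))" if "t > 0" for t
  proof -
    have "(\<lambda>k. t ^ m * (exp (- x * t) * (1 - exp (- c * t))) / c * exp (- t) ^ k) sums
          (t ^ m * (exp (- x * t) * (1 - exp (- c * t))) / c * (1 / (1 - exp (- t))))"
      using that by (intro sums_mult geometric_sums) auto
    also have "(\<lambda>k. t ^ m * (exp (- x * t) * (1 - exp (- c * t))) / c * exp (- t) ^ k) = (\<lambda>k. h k t)"
    proof
      fix k
      have "exp (- t) ^ k = exp (- (real k * t))"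
        by (simp flip: exp_of_nat_mult)
      moreover have "exp (- (x + real k) * t) = exp (- x * t) * exp (- (real k * t))"
        "exp (- (x + c + real k) * t) = exp (- x * t) * exp (- c * t) * exp (- (real k * t))"
        by (simp_all flip: exp_add add: algebra_simps)
      ultimately show "t ^ m * (exp (- x * t) * (1 - exp (- c * t))) / c * exp (- t) ^ k = h k t"
        by (simp add: h_def algebra_simps)
    qed
    finally show ?thesis by (simp add: delta_kernel_def mult_ac)
  qed
  have "ennreal (delta_psi c (Suc m) x) = (\<Sum>k. ennreal (a k))"
    using delta_psi_Suc_sums[OF c x, of m] a_nonneg by (intro suminf_ennreal_eq[symmetric]) (auto simp: a_def)
  also have "\<dots> = (\<Sum>k. \<integral>\<^sup>+t\<in>{0<..}. ennreal (h k t) \<partial>lborel)"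
    by (simp add: h_int)
  also have "\<dots> = (\<integral>\<^sup>+t. (\<Sum>k. ennreal (h k t) * indicator {0<..} t) \<partial>lborel)"
    by (rule nn_integral_suminf[symmetric]) (simp add: h_def)
  also have "\<dots> = (\<integral>\<^sup>+t\<in>{0<..}. ennreal (t ^ m * delta_kernel c t * exp (- x * t)) \<partial>lborel)"
  proof (intro nn_integral_cong)
    fix t :: real
    show "(\<Sum>k. ennreal (h k t) * indicator {0<..} t) = ennreal (t ^ m * delta_kernel c t * exp (- x * t)) * indicator {0<..} t"
    proof (cases "t > 0")
      case True
      thus ?thesis
        using suminf_ennreal_eq[OF h_nonneg[OF True] h_sums[OF True]] by simp
    qed auto
  qed
  finally show ?thesis .
qed

subsection \<open>Complete monotonicity of Laplace transforms\<close>

text \<open>Reduces complete monotonicity to a guess \<open>D\<close> for the signed derivatives.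
  The formula for the iterated \<open>deriv\<close> holds only on the open half-line, so the
  induction passes through a neighbourhood of \<open>x\<close>.\<close>

lemma completely_monotonic_on_derivative_seq:
  assumes deriv: "\<And>k x. x > 0 \<Longrightarrow> (D k has_real_derivative - D (Suc k) x) (at x)"
    and nonneg: "\<And>k x. x > 0 \<Longrightarrow> D k x \<ge> 0"
  shows "completely_monotonic_on {0<..} (D 0)"
proof -
  have D: "(deriv ^^ k) (D 0) x = (-1) ^ k * D k x" if "x > 0" for k x
    using that
  proof (induction k arbitrary: x)
    case (Suc k)
    have "eventually (\<lambda>y. y \<in> {0<..}) (nhds x)"
      using Suc.prems by (intro eventually_nhds_in_open) auto
    hence "eventually (\<lambda>y. (deriv ^^ k) (D 0) y = (-1) ^ k * D k y) (nhds x)"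
      by eventually_elim (use Suc.IH in auto)
    hence "deriv ((deriv ^^ k) (D 0)) x = deriv (\<lambda>y. (-1) ^ k * D k y) x"
      by (rule deriv_cong_ev) simp
    also have "\<dots> = (-1) ^ k * (- D (Suc k) x)"
      by (intro DERIV_imp_deriv DERIV_cmult deriv Suc.prems)
    finally show ?case by simp
  qed auto
  have "(deriv ^^ k) (D 0) field_differentiable at x" if "x > 0" for k x
  proof -
    have "((\<lambda>y. (-1) ^ k * D k y) has_real_derivative (-1) ^ k * (- D (Suc k) x)) (at x)"
      by (intro DERIV_cmult deriv that)
    hence "((deriv ^^ k) (D 0) has_real_derivative (-1) ^ k * (- D (Suc k) x)) (at x)"
      by (rule has_field_derivative_transform_within_open[of _ _ _ "{0<..}"]) (use that D in auto)
    thus ?thesis by (auto simp: field_differentiable_def)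
  qed
  moreover have "(-1) ^ k * (deriv ^^ k) (D 0) x \<ge> 0" if "x > 0" for k x
    using nonneg[OF that, of k] that by (simp add: D flip: mult.assoc power_mult_distrib)
  ultimately show ?thesis
    by (auto simp: completely_monotonic_on_def)
qed

lemma completely_monotonic_on_nonneg:
  "completely_monotonic_on S f \<Longrightarrow> x \<in> S \<Longrightarrow> f x \<ge> 0"
  unfolding completely_monotonic_on_def by (metis funpow_0 mult_1 power_0)

text \<open>
  \<open>D k\<close> plays the role of $(-1)^k f^{(k)}$ for the Laplace transform $f$ of \<open>K\<close>; carrying the whole
  sequence avoids differentiating under the integral sign.
\<close>
definition laplace_seq :: "(nat \<Rightarrow> real \<Rightarrow> real) \<Rightarrow> (real \<Rightarrow> ennreal) \<Rightarrow> bool" where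
  "laplace_seq D K \<longleftrightarrow> K \<in> borel_measurable borel \<and>
     (\<forall>k. \<forall>x>0. D k x \<ge> 0 \<and> (D k has_real_derivative - D (Suc k) x) (at x) \<and>
        ennreal (D k x) = (\<integral>\<^sup>+t\<in>{0<..}. K t * ennreal (t ^ k * exp (- x * t)) \<partial>lborel))"

text \<open>A pointwise inequality of kernels survives integration against the nonnegative weight
  \<open>t ^ k * exp (- x * t)\<close>, so one inequality settles all derivatives at once.\<close>

lemma laplace_seq_mono:
  assumes "laplace_seq D K" "laplace_seq E L" "s \<ge> 0" "x > 0"
    and "\<And>t. t > 0 \<Longrightarrow> ennreal s * L t \<le> K t"
  shows "s * E k x \<le> D k x"
proof -
  have [measurable]: "K \<in> borel_measurable borel" "L \<in> borel_measurable borel"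
    using assms by (auto simp: laplace_seq_def)
  have "ennreal (s * E k x) = ennreal s * (\<integral>\<^sup>+t\<in>{0<..}. L t * ennreal (t ^ k * exp (- x * t)) \<partial>lborel)"
    using assms by (auto simp: laplace_seq_def ennreal_mult)
  also have "\<dots> = (\<integral>\<^sup>+t. ennreal s * (L t * ennreal (t ^ k * exp (- x * t)) * indicator {0<..} t) \<partial>lborel)"
    by (rule nn_integral_cmult[symmetric]) auto
  also have "\<dots> \<le> (\<integral>\<^sup>+t\<in>{0<..}. K t * ennreal (t ^ k * exp (- x * t)) \<partial>lborel)"
  proof (intro nn_integral_mono)
    fix t :: real
    show "ennreal s * (L t * ennreal (t ^ k * exp (- x * t)) * indicator {0<..} t) \<le>
        K t * ennreal (t ^ k * exp (- x * t)) * indicator {0<..} t"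
      using mult_right_mono[OF assms(5)[of t], of "ennreal (t ^ k * exp (- x * t))"]
      by (auto simp: indicator_def mult.assoc)
  qed
  also have "\<dots> = ennreal (D k x)"
    using assms by (auto simp: laplace_seq_def)
  finally show ?thesis
    using assms by (subst (asm) ennreal_le_iff) (auto simp: laplace_seq_def)
qed

text \<open>Only the threshold \<open>s0\<close> needs a kernel inequality; smaller
  \<open>s\<close>, negative ones included, follow from \<open>E k x \<ge> 0\<close>.\<close>

lemma completely_monotonic_laplace_diff:
  assumes K: "laplace_seq D K" and L: "laplace_seq E L" and s: "s0 \<ge> 0" "s \<le> s0"
    and le: "\<And>t. t > 0 \<Longrightarrow> ennreal s0 * L t \<le> K t"
  shows "completely_monotonic_on {0<..} (\<lambda>x. D 0 x - s * E 0 x)"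
proof (rule completely_monotonic_on_derivative_seq[where D = "\<lambda>k x. D k x - s * E k x"])
  fix k :: nat and x :: real
  assume x: "x > 0"
  have "(D k has_real_derivative - D (Suc k) x) (at x)" "(E k has_real_derivative - E (Suc k) x) (at x)"
    using K L x by (auto simp: laplace_seq_def)
  from DERIV_diff[OF this(1) DERIV_cmult[OF this(2), of s]]
  show "((\<lambda>x. D k x - s * E k x) has_real_derivative - (D (Suc k) x - s * E (Suc k) x)) (at x)"
    by (simp add: algebra_simps)
  have "E k x \<ge> 0" using L x by (auto simp: laplace_seq_def)
  hence "s * E k x \<le> s0 * E k x" using s by (intro mult_right_mono)
  also have "\<dots> \<le> D k x" by (rule laplace_seq_mono[OF K L s(1) x le])
  finally show "D k x - s * E k x \<ge> 0" by simp
qed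

text \<open>Mirror image of the preceding result: the kernel inequality is divided by
  \<open>s0\<close>, so that \<open>laplace_seq_mono\<close> applies with the two transforms
  exchanged.\<close>

lemma completely_monotonic_laplace_diff':
  assumes K: "laplace_seq D K" and L: "laplace_seq E L" and s: "s0 > 0" "s \<ge> s0"
    and le: "\<And>t. t > 0 \<Longrightarrow> K t \<le> ennreal s0 * L t"
  shows "completely_monotonic_on {0<..} (\<lambda>x. - (D 0 x - s * E 0 x))"
proof (rule completely_monotonic_on_derivative_seq[where D = "\<lambda>k x. - (D k x - s * E k x)"])
  fix k :: nat and x :: real
  assume x: "x > 0"
  have "(D k has_real_derivative - D (Suc k) x) (at x)" "(E k has_real_derivative - E (Suc k) x) (at x)"
    using K L x by (auto simp: laplace_seq_def)
  from DERIV_diff[OF DERIV_cmult[OF this(2), of s] this(1)]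
  show "((\<lambda>x. - (D k x - s * E k x)) has_real_derivative - (- (D (Suc k) x - s * E (Suc k) x))) (at x)"
    by (simp add: algebra_simps)
  have "ennreal (1 / s0) * K t \<le> L t" if "t > 0" for t
  proof -
    have "ennreal (1 / s0) * K t \<le> ennreal (1 / s0) * (ennreal s0 * L t)"
      using le[OF that] by (rule mult_left_mono) simp
    also have "\<dots> = L t"
      using s by (simp add: ennreal_mult'[symmetric] flip: mult.assoc)
    finally show ?thesis .
  qed
  hence "1 / s0 * D k x \<le> E k x"
    using s by (intro laplace_seq_mono[OF L K _ x]) auto
  hence "D k x \<le> s0 * E k x" using s by (simp add: field_simps)
  moreover have "E k x \<ge> 0" using L x by (auto simp: laplace_seq_def)
  hence "s0 * E k x \<le> s * E k x" using s by (intro mult_right_mono)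
  ultimately show "- (D k x - s * E k x) \<ge> 0" by simp
qed

text \<open>Restricting \<open>u\<close> to the open interval keeps both arguments positive, so the
  values of the kernels at nonpositive arguments never enter.\<close>

definition half_line_conv :: "(real \<Rightarrow> ennreal) \<Rightarrow> (real \<Rightarrow> ennreal) \<Rightarrow> real \<Rightarrow> ennreal" where
  "half_line_conv K L t = (\<integral>\<^sup>+u\<in>{0<..<t}. K u * L (t - u) \<partial>lborel)"

text \<open>Pascal's rule. The signs are absorbed in the sequences, so this is the inductive step of
  the Leibniz formula without signs; the extra term vanishes because
  \<open>k choose Suc k = 0\<close>.\<close>

lemma Leibniz_sum_Suc:
  fixes a b :: "nat \<Rightarrow> real"
  shows "(\<Sum>j\<le>k. real (k choose j) * (a (Suc j) * b (k - j) + a j * b (Suc (k - j)))) =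
         (\<Sum>j\<le>Suc k. real (Suc k choose j) * (a j * b (Suc k - j)))"
proof -
  have "(\<Sum>j\<le>Suc k. real (Suc k choose j) * (a j * b (Suc k - j))) =
     a 0 * b (Suc k) + (\<Sum>j\<le>k. real (Suc k choose Suc j) * (a (Suc j) * b (k - j)))"
    by (subst sum.atMost_Suc_shift) simp
  also have "(\<Sum>j\<le>k. real (Suc k choose Suc j) * (a (Suc j) * b (k - j))) =
    (\<Sum>j\<le>k. real (k choose j) * (a (Suc j) * b (k - j))) + (\<Sum>j\<le>k. real (k choose Suc j) * (a (Suc j) * b (k - j)))"
    by (simp add: algebra_simps sum.distrib)
  also have "a 0 * b (Suc k) + (\<dots>) = (\<Sum>j\<le>k. real (k choose j) * (a (Suc j) * b (k - j))) +
      (\<Sum>j\<le>Suc k. real (k choose j) * (a j * b (Suc k - j)))"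
    by (simp add: sum.atMost_Suc_shift[of _ k] del: sum.atMost_Suc)
  also have "(\<Sum>j\<le>Suc k. real (k choose j) * (a j * b (Suc k - j))) = (\<Sum>j\<le>k. real (k choose j) * (a j * b (Suc (k - j))))"
    by (simp add: Suc_diff_le)
  finally show ?thesis by (simp add: sum.distrib algebra_simps)
qed

text \<open>The convolution theorem for all derivatives together: after Tonelli and
  \<open>t = u + v\<close> the exponential factorises, and the binomial expansion of
  \<open>(u + v) ^ k\<close> produces the same sum as the Leibniz rule for the product of the
  transforms.\<close>

lemma laplace_seq_mult:
  assumes K: "laplace_seq D K" and L: "laplace_seq E L"
  shows "laplace_seq (\<lambda>k x. \<Sum>j\<le>k. real (k choose j) * (D j x * E (k - j) x)) (half_line_conv K L)"
proof -
  have [measurable]: "K \<in> borel_measurable borel" "L \<in> borel_measurable borel"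
    using assms by (auto simp: laplace_seq_def)
  \<comment> \<open>Extension by zero turns the convolution into an integral over the whole line,
    where exchange and translation involve no variable limits.\<close>
  define KK where "KK t = K t * indicator {0<..} t" for t
  define LL where "LL t = L t * indicator {0<..} t" for t
  have [measurable]: "KK \<in> borel_measurable borel" "LL \<in> borel_measurable borel"
    unfolding KK_def LL_def by measurable
  have half_line_conv_eq: "half_line_conv K L t = (\<integral>\<^sup>+u. KK u * LL (t - u) \<partial>lborel)" for t
    unfolding half_line_conv_def by (intro nn_integral_cong) (auto simp: KK_def LL_def indicator_def)
  have half_line_conv_nonpos: "half_line_conv K L t = 0" if "t \<le> 0" for t
    using that by (simp add: half_line_conv_def)
  have meas: "half_line_conv K L \<in> borel_measurable borel"
    unfolding half_line_conv_eq by measurable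
  have int: "ennreal (\<Sum>j\<le>k. real (k choose j) * (D j x * E (k - j) x)) =
     (\<integral>\<^sup>+t\<in>{0<..}. half_line_conv K L t * ennreal (t ^ k * exp (- x * t)) \<partial>lborel)" if x: "x > 0" for k x
  proof -
    define A where "A j = (\<integral>\<^sup>+u. KK u * ennreal (u ^ j * exp (- x * u)) \<partial>lborel)" for j
    define B where "B j = (\<integral>\<^sup>+u. LL u * ennreal (u ^ j * exp (- x * u)) \<partial>lborel)" for j
    have A: "A j = ennreal (D j x)" and B: "B j = ennreal (E j x)" for j
      using K L x by (auto simp: laplace_seq_def A_def B_def KK_def LL_def mult_ac)
    have nonneg: "D j x \<ge> 0" "E j x \<ge> 0" for j
      using K L x by (auto simp: laplace_seq_def)
    have "(\<integral>\<^sup>+t\<in>{0<..}. half_line_conv K L t * ennreal (t ^ k * exp (- x * t)) \<partial>lborel) =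
          (\<integral>\<^sup>+t. (\<integral>\<^sup>+u. KK u * LL (t - u) * ennreal (t ^ k * exp (- x * t)) \<partial>lborel) \<partial>lborel)"
    proof (intro nn_integral_cong)
      fix t :: real
      have "half_line_conv K L t * ennreal (t ^ k * exp (- x * t)) * indicator {0<..} t =
            half_line_conv K L t * ennreal (t ^ k * exp (- x * t))"
        by (cases "t > 0") (auto simp: half_line_conv_nonpos)
      thus "half_line_conv K L t * ennreal (t ^ k * exp (- x * t)) * indicator {0<..} t =
          (\<integral>\<^sup>+u. KK u * LL (t - u) * ennreal (t ^ k * exp (- x * t)) \<partial>lborel)"
        by (simp add: half_line_conv_eq nn_integral_multc)
    qed
    also have "\<dots> = (\<integral>\<^sup>+u. (\<integral>\<^sup>+t. KK u * LL (t - u) * ennreal (t ^ k * exp (- x * t)) \<partial>lborel) \<partial>lborel)"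
      by (rule lborel_pair.Fubini') measurable
    also have "\<dots> = (\<integral>\<^sup>+u. (\<integral>\<^sup>+v. KK u * LL v * ennreal ((u + v) ^ k * exp (- x * (u + v))) \<partial>lborel) \<partial>lborel)"
    proof (rule nn_integral_cong)
      fix u :: real
      show "(\<integral>\<^sup>+t. KK u * LL (t - u) * ennreal (t ^ k * exp (- x * t)) \<partial>lborel) =
            (\<integral>\<^sup>+v. KK u * LL v * ennreal ((u + v) ^ k * exp (- x * (u + v))) \<partial>lborel)"
        by (subst nn_integral_real_affine[where c=1 and t=u]) auto
    qed
    also have "\<dots> = (\<integral>\<^sup>+u. (\<integral>\<^sup>+v. (\<Sum>j\<le>k. ennreal (real (k choose j)) * (KK u * ennreal (u ^ j * exp (- x * u)))
          * (LL v * ennreal (v ^ (k - j) * exp (- x * v)))) \<partial>lborel) \<partial>lborel)"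
    proof (intro nn_integral_cong)
      fix u v :: real
      show "KK u * LL v * ennreal ((u + v) ^ k * exp (- x * (u + v))) =
         (\<Sum>j\<le>k. ennreal (real (k choose j)) * (KK u * ennreal (u ^ j * exp (- x * u)))
          * (LL v * ennreal (v ^ (k - j) * exp (- x * v))))"
      proof (cases "u > 0 \<and> v > 0")
        case True
        have "(u + v) ^ k * exp (- x * (u + v)) =
          (\<Sum>j\<le>k. real (k choose j) * ((u ^ j * exp (- x * u)) * (v ^ (k - j) * exp (- x * v))))"
        proof -
          have "exp (- x * (u + v)) = exp (- x * u) * exp (- x * v)"
            by (simp flip: exp_add add: algebra_simps)
          thus ?thesis by (simp add: binomial_ring sum_distrib_right sum_distrib_left mult_ac)
        qed
        also have "ennreal \<dots> = (\<Sum>j\<le>k. ennreal (real (k choose j)) * (ennreal (u ^ j * exp (- x * u)) * ennreal (v ^ (k - j) * exp (- x * v))))"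
          using True by (subst sum_ennreal[symmetric]) (auto simp: ennreal_mult intro!: sum.cong)
        finally show ?thesis by (simp add: sum_distrib_left mult_ac)
      qed (auto simp: KK_def LL_def)
    qed
    also have "\<dots> = (\<integral>\<^sup>+u. (\<Sum>j\<le>k. ennreal (real (k choose j)) * (KK u * ennreal (u ^ j * exp (- x * u))) * B (k - j)) \<partial>lborel)"
      by (subst nn_integral_sum) (auto simp: nn_integral_cmult B_def)
    also have "\<dots> = (\<Sum>j\<le>k. ennreal (real (k choose j)) * A j * B (k - j))"
      by (subst nn_integral_sum) (auto simp: nn_integral_cmult nn_integral_multc A_def)
    also have "\<dots> = (\<Sum>j\<le>k. ennreal (real (k choose j) * (D j x * E (k - j) x)))"
      using nonneg by (intro sum.cong) (auto simp: A B ennreal_mult mult_ac)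
    also have "\<dots> = ennreal (\<Sum>j\<le>k. real (k choose j) * (D j x * E (k - j) x))"
      using nonneg by (intro sum_ennreal) auto
    finally show ?thesis by simp
  qed
  have der: "((\<lambda>x. \<Sum>j\<le>k. real (k choose j) * (D j x * E (k - j) x)) has_real_derivative
      - (\<Sum>j\<le>Suc k. real (Suc k choose j) * (D j x * E (Suc k - j) x))) (at x)" if x: "x > 0" for k x
  proof -
    have dD: "(D j has_real_derivative - D (Suc j) x) (at x)" and dE: "(E j has_real_derivative - E (Suc j) x) (at x)" for j
      using K L x by (auto simp: laplace_seq_def)
    have "((\<lambda>x. \<Sum>j\<le>k. real (k choose j) * (D j x * E (k - j) x)) has_real_derivative
      (\<Sum>j\<le>k. real (k choose j) * (- D (Suc j) x * E (k - j) x + - E (Suc (k - j)) x * D j x))) (at x)"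
      by (intro DERIV_sum DERIV_cmult DERIV_mult dD dE)
    also have "(\<Sum>j\<le>k. real (k choose j) * (- D (Suc j) x * E (k - j) x + - E (Suc (k - j)) x * D j x)) =
      - (\<Sum>j\<le>k. real (k choose j) * (D (Suc j) x * E (k - j) x + D j x * E (Suc (k - j)) x))"
      by (simp add: sum_negf[symmetric] algebra_simps)
    also have "\<dots> = - (\<Sum>j\<le>Suc k. real (Suc k choose j) * (D j x * E (Suc k - j) x))"
      by (simp only: Leibniz_sum_Suc[of k "\<lambda>j. D j x" "\<lambda>j. E j x"])
    finally show ?thesis .
  qed
  show ?thesis
    unfolding laplace_seq_def using meas int der K L
    by (auto simp: laplace_seq_def intro!: sum_nonneg)
qed

text \<open>The index \<open>Suc m\<close> belongs to the exponent \<open>m\<close>; raising the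
  index by \<open>k\<close> multiplies the kernel by \<open>t ^ k\<close>, exactly as
  \<open>k\<close> differentiations of the transform do.\<close>

lemma laplace_seq_delta_psi:
  assumes c: "c > 0"
  shows "laplace_seq (\<lambda>k. delta_psi c (Suc (m + k))) (\<lambda>t. ennreal (t ^ m * delta_kernel c t))"
  unfolding laplace_seq_def
proof (intro conjI allI impI)
  fix k and x :: real
  assume x: "x > 0"
  show "delta_psi c (Suc (m + k)) x \<ge> 0"
    using c x by (rule delta_psi_Suc_nonneg)
  show "(delta_psi c (Suc (m + k)) has_real_derivative - delta_psi c (Suc (m + Suc k)) x) (at x)"
    using delta_psi_Suc_has_derivative[OF c x, of "m + k"] by simp
  have "ennreal (t ^ (m + k) * delta_kernel c t * exp (- x * t)) * indicator {0<..} t =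
      ennreal (t ^ m * delta_kernel c t) * ennreal (t ^ k * exp (- x * t)) * indicator {0<..} t" for t
    using delta_kernel_pos[OF c, of t]
    by (cases "t > 0") (auto simp: power_add mult_ac simp flip: ennreal_mult')
  thus "ennreal (delta_psi c (Suc (m + k)) x) =
      (\<integral>\<^sup>+t\<in>{0<..}. ennreal (t ^ m * delta_kernel c t) * ennreal (t ^ k * exp (- x * t)) \<partial>lborel)"
    unfolding delta_psi_Suc_integral[OF c x] by (intro nn_integral_cong) auto
qed measurable

subsection \<open>Logarithmic convexity of the kernel\<close>

text \<open>Convexity of \<open>sinh\<close> on the half-line together with
  \<open>sinh 0 = 0\<close>; equivalently, \<open>sinh y / y\<close> increases there.\<close>

lemma sinh_mult_le:
  fixes c x :: real
  assumes "0 \<le> c" "c \<le> 1" "x \<ge> 0"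
  shows "sinh (c * x) \<le> c * sinh x"
proof -
  have "(\<lambda>x. c * sinh x - sinh (c * x)) 0 \<le> (\<lambda>x. c * sinh x - sinh (c * x)) x"
  proof (rule DERIV_nonneg_imp_nondecreasing[OF assms(3)])
    fix y :: real assume y: "0 \<le> y" "y \<le> x"
    have "((\<lambda>x. c * sinh x - sinh (c * x)) has_real_derivative c * (cosh y - cosh (c * y))) (at y)"
      by (auto intro!: derivative_eq_intros simp: algebra_simps)
    moreover have "c * y \<le> y"
      using assms y mult_right_mono[of c 1 y] by simp
    hence "cosh (c * y) \<le> cosh y"
      using assms y by (subst cosh_real_nonneg_le_iff) auto
    ultimately show "\<exists>d. ((\<lambda>x. c * sinh x - sinh (c * x)) has_real_derivative d) (at y) \<and> d \<ge> 0"
      using assms by (intro exI[of _ "c * (cosh y - cosh (c * y))"]) auto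
  qed
  thus ?thesis by simp
qed

lemma sinh_ge_self: "x \<ge> 0 \<Longrightarrow> x \<le> sinh x" for x :: real
proof -
  assume x: "x \<ge> 0"
  have "(\<lambda>x. sinh x - x) 0 \<le> (\<lambda>x. sinh x - x) x"
  proof (rule DERIV_nonneg_imp_nondecreasing[OF x])
    fix y :: real
    have "((\<lambda>x. sinh x - x) has_real_derivative cosh y - 1) (at y)"
      by (auto intro!: derivative_eq_intros)
    thus "\<exists>d. ((\<lambda>x. sinh x - x) has_real_derivative d) (at y) \<and> d \<ge> 0"
      using cosh_real_ge_1[of y] by (intro exI[of _ "cosh y - 1"]) auto
  qed
  thus ?thesis by simp
qed

definition dlog_one_minus_exp :: "real \<Rightarrow> real \<Rightarrow> real" where
  "dlog_one_minus_exp c t = c / (exp (c * t) - 1)"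

lemma has_derivative_ln_one_minus_exp:
  fixes c t :: real
  assumes "c > 0" "t > 0"
  shows "((\<lambda>t. ln (1 - exp (- c * t))) has_real_derivative dlog_one_minus_exp c t) (at t)"
proof -
  have "exp (c * t) > 1" using assms by simp
  thus ?thesis
    using assms unfolding dlog_one_minus_exp_def
    by (auto intro!: derivative_eq_intros simp: field_simps exp_minus)
qed

text \<open>With the half argument in \<open>sinh\<close>, comparing two parameters becomes
  monotonicity of \<open>sinh y / y\<close>, and comparing with \<open>1 / t ^ 2\<close> becomes
  \<open>y \<le> sinh y\<close>.\<close>

lemma has_derivative_dlog_one_minus_exp:
  assumes "c > 0" "t > 0"
  shows "(dlog_one_minus_exp c has_real_derivative - (c / (2 * sinh (c * t / 2)))\<^sup>2) (at t)"
proof -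
  have e: "exp (c * t) > 1" using assms by simp
  have "(dlog_one_minus_exp c has_real_derivative - (c^2 * exp (c * t) / (exp (c * t) - 1)^2)) (at t)"
    using e unfolding dlog_one_minus_exp_def
    by (auto intro!: derivative_eq_intros simp: field_simps power2_eq_square)
  also have "c^2 * exp (c * t) / (exp (c * t) - 1)^2 = (c / (2 * sinh (c * t / 2)))\<^sup>2"
  proof -
    define z where "z = exp (c * t / 2)"
    have z: "exp (c * t) = z ^ 2" "exp (- (c * t / 2)) = 1 / z" "z > 1"
      using assms by (auto simp: z_def exp_minus field_simps simp flip: exp_double)
    have "2 * sinh (c * t / 2) = z - 1 / z"
      by (simp add: sinh_field_def z flip: z_def)
    also have "\<dots> = (z^2 - 1) / z"
      using z by (simp add: field_simps power2_eq_square)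
    finally show ?thesis
      unfolding z by (simp add: power_divide power_mult_distrib)
  qed
  finally show ?thesis .
qed

text \<open>The inner points are complementary convex combinations of \<open>a\<close> and
  \<open>b\<close>: if \<open>b\<close> has weight \<open>l\<close> in \<open>a'\<close>, the fixed
  sum forces weight \<open>1 - l\<close> in \<open>b'\<close>. Adding the two convexity inequalities
  eliminates \<open>l\<close>.\<close>

lemma convex_on_majorization:
  fixes f :: "real \<Rightarrow> real"
  assumes f: "convex_on {0<..} f" and ab: "0 < a" "a \<le> a'" "a' \<le> b" "a + b = a' + b'"
  shows "f a' + f b' \<le> f a + f b"
proof (cases "a = b")
  case True
  thus ?thesis using ab by (simp add: add_increasing)
next
  case False
  define l where "l = (a' - a) / (b - a)"
  have l: "0 \<le> l" "l \<le> 1" using ab False by (auto simp: l_def field_simps)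
  have eq: "l * (b - a) = a' - a" using False by (simp add: l_def)
  have a': "a' = (1 - l) *\<^sub>R a + l *\<^sub>R b" and b': "b' = (1 - (1 - l)) *\<^sub>R a + (1 - l) *\<^sub>R b"
    using eq ab by (simp_all add: algebra_simps)
  have "f a' \<le> (1 - l) * f a + l * f b"
    unfolding a' using l ab False by (intro convex_onD[OF f]) auto
  moreover have "f b' \<le> (1 - (1 - l)) * f a + (1 - l) * f b"
    unfolding b' using l ab False by (intro convex_onD[OF f]) auto
  ultimately show ?thesis by (simp add: algebra_simps)
qed

lemma majorization_from_ln:
  fixes w :: "real \<Rightarrow> real"
  assumes w: "\<And>t. t > 0 \<Longrightarrow> w t > 0" and f: "convex_on {0<..} (\<lambda>t. ln (w t))"
    and ab: "0 < a" "a \<le> a'" "a' \<le> b" "a + b = a' + b'"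
  shows "w a' * w b' \<le> w a * w b"
proof -
  have pos: "w a > 0" "w b > 0" "w a' > 0" "w b' > 0"
    using ab by (auto intro!: w)
  have "ln (w a' * w b') \<le> ln (w a * w b)"
    using convex_on_majorization[OF f ab] pos by (simp add: ln_mult)
  thus ?thesis using pos by simp
qed

lemma ln_delta_kernel:
  assumes "c > 0" "t > 0"
  shows "ln (delta_kernel c t) = ln (1 - exp (- c * t)) - ln (1 - exp (- 1 * t)) - ln c"
proof -
  have "1 - exp (- c * t) > 0" "1 - exp (- t) > 0" using assms by auto
  thus ?thesis using assms by (simp add: delta_kernel_def ln_div ln_mult)
qed

text \<open>This decides the sign of the second derivative of \<open>ln (delta_kernel c t)\<close>:
  the parameters \<open>c\<close> and 1 are compared, in either order. It is
  \<open>sinh_mult_le\<close> for the ratio \<open>c / d\<close>.\<close>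

lemma sinh_quotient_mono:
  fixes c d t :: real
  assumes "0 < c" "c \<le> d" "t > 0"
  shows "(d / (2 * sinh (d * t / 2)))\<^sup>2 \<le> (c / (2 * sinh (c * t / 2)))\<^sup>2"
proof -
  have "sinh (c / d * (d * t / 2)) \<le> c / d * sinh (d * t / 2)"
    using assms by (intro sinh_mult_le) auto
  hence "d * sinh (c * t / 2) \<le> c * sinh (d * t / 2)"
    using assms by (simp add: field_simps)
  moreover have "sinh (c * t / 2) > 0" "sinh (d * t / 2) > 0"
    using assms by auto
  ultimately have "d / (2 * sinh (d * t / 2)) \<le> c / (2 * sinh (c * t / 2))"
    by (simp add: field_simps)
  thus ?thesis
    using assms by (intro power_mono) auto
qed

lemma ln_delta_kernel_deriv:
  assumes "c > 0" "t > 0"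
  shows "((\<lambda>t. ln (delta_kernel c t)) has_real_derivative dlog_one_minus_exp c t - dlog_one_minus_exp 1 t) (at t)"
proof -
  have "((\<lambda>t. ln (1 - exp (- c * t)) - ln (1 - exp (- 1 * t)) - ln c) has_real_derivative
      dlog_one_minus_exp c t - dlog_one_minus_exp 1 t - 0) (at t)"
    using assms by (intro DERIV_diff has_derivative_ln_one_minus_exp) auto
  hence "((\<lambda>t. ln (1 - exp (- c * t)) - ln (1 - exp (- 1 * t)) - ln c) has_real_derivative
      dlog_one_minus_exp c t - dlog_one_minus_exp 1 t) (at t)" by simp
  thus ?thesis
    by (rule has_field_derivative_transform_within_open[where S="{0<..}"]) (use assms ln_delta_kernel in auto)
qed

lemma delta_kernel_log_convex:
  assumes "c \<ge> 1"
  shows "convex_on {0<..} (\<lambda>t. ln (delta_kernel c t))"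
proof (rule f''_ge0_imp_convex[where f' = "\<lambda>t. dlog_one_minus_exp c t - dlog_one_minus_exp 1 t"
      and f'' = "\<lambda>t. - (c / (2 * sinh (c * t / 2)))\<^sup>2 - (- (1 / (2 * sinh (1 * t / 2)))\<^sup>2)"])
  fix t :: real assume t: "t \<in> {0<..}"
  show "((\<lambda>t. ln (delta_kernel c t)) has_real_derivative dlog_one_minus_exp c t - dlog_one_minus_exp 1 t) (at t)"
    using assms t by (intro ln_delta_kernel_deriv) auto
  show "((\<lambda>t. dlog_one_minus_exp c t - dlog_one_minus_exp 1 t) has_real_derivative
      - (c / (2 * sinh (c * t / 2)))\<^sup>2 - (- (1 / (2 * sinh (1 * t / 2)))\<^sup>2)) (at t)"
    using assms t by (intro DERIV_diff has_derivative_dlog_one_minus_exp) auto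
  show "0 \<le> - (c / (2 * sinh (c * t / 2)))\<^sup>2 - (- (1 / (2 * sinh (1 * t / 2)))\<^sup>2)"
    using sinh_quotient_mono[of 1 c t] assms t by simp
qed auto

text \<open>Phrased through the inverse, so that the majorization result for log-convex functions
  serves here too.\<close>

lemma delta_kernel_log_concave:
  assumes "0 < c" "c \<le> 1"
  shows "convex_on {0<..} (\<lambda>t. ln (inverse (delta_kernel c t)))"
proof (rule f''_ge0_imp_convex[where f' = "\<lambda>t. - (dlog_one_minus_exp c t - dlog_one_minus_exp 1 t)"
      and f'' = "\<lambda>t. - (- (c / (2 * sinh (c * t / 2)))\<^sup>2 - (- (1 / (2 * sinh (1 * t / 2)))\<^sup>2))"])
  fix t :: real assume t: "t \<in> {0<..}"
  have "((\<lambda>t. - ln (delta_kernel c t)) has_real_derivative - (dlog_one_minus_exp c t - dlog_one_minus_exp 1 t)) (at t)"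
    using assms t by (intro DERIV_minus ln_delta_kernel_deriv) auto
  thus "((\<lambda>t. ln (inverse (delta_kernel c t))) has_real_derivative - (dlog_one_minus_exp c t - dlog_one_minus_exp 1 t)) (at t)"
    by (rule has_field_derivative_transform_within_open[where S="{0<..}"])
       (use assms t delta_kernel_pos[OF assms(1)] in \<open>auto simp: ln_inverse\<close>)
  show "((\<lambda>t. - (dlog_one_minus_exp c t - dlog_one_minus_exp 1 t)) has_real_derivative
      - (- (c / (2 * sinh (c * t / 2)))\<^sup>2 - (- (1 / (2 * sinh (1 * t / 2)))\<^sup>2))) (at t)"
    using assms t by (intro DERIV_minus DERIV_diff has_derivative_dlog_one_minus_exp) auto
  show "0 \<le> - (- (c / (2 * sinh (c * t / 2)))\<^sup>2 - (- (1 / (2 * sinh (1 * t / 2)))\<^sup>2))"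
    using sinh_quotient_mono[of c 1 t] assms t by simp
qed auto

text \<open>Dividing by \<open>t\<close> adds \<open>1 / t ^ 2\<close> to the second derivative of
  the logarithm. By \<open>sinh_ge_self\<close> this outweighs the only negative term, whatever
  \<open>c\<close> is.\<close>

lemma delta_kernel_over_id_log_convex:
  assumes c: "c > 0"
  shows "convex_on {0<..} (\<lambda>t. ln (delta_kernel c t / t))"
proof (rule f''_ge0_imp_convex[where f' = "\<lambda>t. (dlog_one_minus_exp c t - dlog_one_minus_exp 1 t) - 1 / t"
      and f'' = "\<lambda>t. (- (c / (2 * sinh (c * t / 2)))\<^sup>2 - (- (1 / (2 * sinh (1 * t / 2)))\<^sup>2)) - (- 1 / t ^ 2)"])
  fix t :: real assume "t \<in> {0<..}"
  hence t: "t > 0" by simp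
  have "((\<lambda>t. ln (delta_kernel c t) - ln t) has_real_derivative (dlog_one_minus_exp c t - dlog_one_minus_exp 1 t) - 1 / t) (at t)"
    using c t by (intro DERIV_diff ln_delta_kernel_deriv) (auto intro!: derivative_eq_intros)
  thus "((\<lambda>t. ln (delta_kernel c t / t)) has_real_derivative (dlog_one_minus_exp c t - dlog_one_minus_exp 1 t) - 1 / t) (at t)"
    by (rule has_field_derivative_transform_within_open[where S="{0<..}"])
       (use t in \<open>simp_all add: ln_div delta_kernel_pos[OF c] delta_kernel_pos[OF c, THEN less_imp_neq, THEN not_sym]\<close>)
  have "((\<lambda>t. 1 / t) has_real_derivative - 1 / t ^ 2) (at t)"
    using t by (auto intro!: derivative_eq_intros simp: power2_eq_square)
  thus "((\<lambda>t. (dlog_one_minus_exp c t - dlog_one_minus_exp 1 t) - 1 / t) has_real_derivative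
      (- (c / (2 * sinh (c * t / 2)))\<^sup>2 - (- (1 / (2 * sinh (1 * t / 2)))\<^sup>2)) - (- 1 / t ^ 2)) (at t)"
    using c t by (intro DERIV_diff has_derivative_dlog_one_minus_exp) auto
  have "c * t / 2 \<le> sinh (c * t / 2)"
    using c t by (intro sinh_ge_self) auto
  moreover have "sinh (c * t / 2) > 0" using c t by auto
  ultimately have "c / (2 * sinh (c * t / 2)) \<le> 1 / t"
    using t by (simp add: field_simps)
  hence "(c / (2 * sinh (c * t / 2)))\<^sup>2 \<le> (1 / t)\<^sup>2"
    using c t by (intro power_mono) auto
  moreover have "0 \<le> (1 / (2 * sinh (1 * t / 2)))\<^sup>2" by simp
  ultimately show "0 \<le> (- (c / (2 * sinh (c * t / 2)))\<^sup>2 - (- (1 / (2 * sinh (1 * t / 2)))\<^sup>2)) - (- 1 / t ^ 2)"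
    unfolding power_one_over by linarith
qed auto

text \<open>The graph of \<open>exp\<close> lies below its chord between 0 and \<open>d * t\<close>,
  evaluated at \<open>c * t\<close>. Comparing \<open>c\<close> with 1 gives the sign of the
  logarithmic derivative of the kernel.\<close>

lemma dlog_one_minus_exp_antimono:
  assumes "0 < c" "c \<le> d" "t > 0"
  shows "dlog_one_minus_exp d t \<le> dlog_one_minus_exp c t"
proof -
  have "exp ((1 - c / d) *\<^sub>R 0 + (c / d) *\<^sub>R (d * t)) \<le> (1 - c / d) * exp 0 + (c / d) * exp (d * t)"
    using assms by (intro convex_onD[OF exp_convex]) auto
  hence "exp (c * t) - 1 \<le> c / d * (exp (d * t) - 1)"
    using assms by (simp add: algebra_simps)
  hence "d * (exp (c * t) - 1) \<le> c * (exp (d * t) - 1)"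
    using assms by (simp add: field_simps)
  moreover have "exp (c * t) > 1" "exp (d * t) > 1"
    using assms by auto
  ultimately show ?thesis
    using assms unfolding dlog_one_minus_exp_def by (simp add: divide_simps mult_ac)
qed

text \<open>Both bounds come from \<open>y / (1 + y) \<le> 1 - exp (- y) \<le> y\<close>. They hold
  on the whole half-line with an error linear in \<open>t\<close>, which costs one extra factor
  \<open>1 / x\<close> in the Laplace integral and so vanishes as \<open>x\<close> grows.\<close>

lemma delta_kernel_bounds:
  assumes c: "c > 0" and t: "t > 0"
  shows "1 - c * t \<le> delta_kernel c t" "delta_kernel c t \<le> 1 + t"
proof -
  have ub: "1 - exp (- y) \<le> y" for y :: real
    using exp_ge_add_one_self[of "-y"] by simp
  have lb: "y / (1 + y) \<le> 1 - exp (- y)" if "y > 0" for y :: real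
  proof -
    have "exp (- y) \<le> 1 / (1 + y)"
      using exp_ge_add_one_self[of y] that by (simp add: exp_minus field_simps)
    also have "\<dots> = 1 - y / (1 + y)"
      using that by (simp add: field_simps)
    finally show ?thesis by simp
  qed
  have pos: "1 - exp (- t) > 0" "1 + t > 0" "1 + c * t > 0"
    using c t by (auto intro: add_pos_pos)
  have "delta_kernel c t \<le> (c * t) / (c * (t / (1 + t)))"
    unfolding delta_kernel_def using ub[of "c * t"] lb[OF t] c t
    by (intro frac_le mult_left_mono) auto
  also have "\<dots> = 1 + t" using c t by simp
  finally show "delta_kernel c t \<le> 1 + t" .
  have "(1 - c * t) * (1 + c * t) \<le> 1"
    using c t by (simp add: algebra_simps)
  hence "1 - c * t \<le> 1 / (1 + c * t)"
    using pos by (simp add: field_simps)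
  also have "\<dots> = (c * t / (1 + c * t)) / (c * t)"
    using c t by simp
  also have "\<dots> \<le> delta_kernel c t"
    unfolding delta_kernel_def using lb[of "c * t"] ub[of t] c t pos
    by (intro frac_le mult_left_mono) auto
  finally show "1 - c * t \<le> delta_kernel c t" .
qed

text \<open>The formula itself has the value 0 at \<open>t = 0\<close> by the convention for
  division by zero, so the natural value 1 is available only as a limit.\<close>

lemma delta_kernel_tendsto_1:
  assumes c: "c > 0"
  shows "(delta_kernel c \<longlongrightarrow> 1) (at_right 0)"
proof -
  have "((\<lambda>t. (1 - exp (- c * t)) / (c * (1 - exp (- t)))) \<longlongrightarrow> 1) (at_right 0)"
    using c by real_asymp
  thus ?thesis by (simp add: delta_kernel_def[abs_def])
qed

subsection \<open>A Chebyshev inequality for convolutions\<close>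

text \<open>
  The usual integration of the comonotonicity assumption over \<open>(x, y)\<close>, with the negative terms moved
  to the other side because the integrals are taken in \<^typ>\<open>ennreal\<close>.
\<close>
lemma nn_Chebyshev:
  fixes P Q W :: "'a \<Rightarrow> real"
  assumes [measurable]: "P \<in> borel_measurable M" "Q \<in> borel_measurable M" "W \<in> borel_measurable M"
    and nonneg: "\<And>x. x \<in> space M \<Longrightarrow> P x \<ge> 0" "\<And>x. x \<in> space M \<Longrightarrow> Q x \<ge> 0" "\<And>x. x \<in> space M \<Longrightarrow> W x \<ge> 0"
    and comon: "\<And>x y. x \<in> space M \<Longrightarrow> y \<in> space M \<Longrightarrow> (P x * Q y - Q x * P y) * (W x - W y) \<ge> 0"
  shows "(\<integral>\<^sup>+x. P x \<partial>M) * (\<integral>\<^sup>+x. Q x * W x \<partial>M) \<le> (\<integral>\<^sup>+x. P x * W x \<partial>M) * (\<integral>\<^sup>+x. Q x \<partial>M)"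
proof -
  let ?P = "\<integral>\<^sup>+x. P x \<partial>M" and ?Q = "\<integral>\<^sup>+x. Q x \<partial>M"
  let ?PW = "\<integral>\<^sup>+x. P x * W x \<partial>M" and ?QW = "\<integral>\<^sup>+x. Q x * W x \<partial>M"
  have double: "(\<integral>\<^sup>+x. (\<integral>\<^sup>+y. ennreal (f x) * ennreal (g y) + ennreal (f' x) * ennreal (g' y) \<partial>M) \<partial>M) =
      (\<integral>\<^sup>+x. f x \<partial>M) * (\<integral>\<^sup>+y. g y \<partial>M) + (\<integral>\<^sup>+x. f' x \<partial>M) * (\<integral>\<^sup>+y. g' y \<partial>M)"
    if [measurable]: "f \<in> borel_measurable M" "g \<in> borel_measurable M"
       "f' \<in> borel_measurable M" "g' \<in> borel_measurable M" for f g f' g' :: "'a \<Rightarrow> real"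
  proof -
    have "(\<integral>\<^sup>+y. ennreal (f x) * ennreal (g y) + ennreal (f' x) * ennreal (g' y) \<partial>M) =
        ennreal (f x) * (\<integral>\<^sup>+y. g y \<partial>M) + ennreal (f' x) * (\<integral>\<^sup>+y. g' y \<partial>M)" for x
      by (subst nn_integral_add) (simp_all add: nn_integral_cmult)
    thus ?thesis
      by (simp add: nn_integral_add nn_integral_multc)
  qed
  have "?P * ?QW + ?QW * ?P =
     (\<integral>\<^sup>+x. (\<integral>\<^sup>+y. ennreal (P x) * ennreal (Q y * W y) + ennreal (Q x * W x) * ennreal (P y) \<partial>M) \<partial>M)"
    by (rule double[symmetric]) measurable
  also have "\<dots> \<le> (\<integral>\<^sup>+x. (\<integral>\<^sup>+y. ennreal (P x * W x) * ennreal (Q y) + ennreal (Q x) * ennreal (P y * W y) \<partial>M) \<partial>M)"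
  proof (rule nn_integral_mono, rule nn_integral_mono)
    fix x y assume xy: "x \<in> space M" "y \<in> space M"
    have "P x * (Q y * W y) + Q x * W x * P y \<le> P x * W x * Q y + Q x * (P y * W y)"
      using comon[OF xy] by (simp only: algebra_simps)
    hence "ennreal (P x * (Q y * W y) + Q x * W x * P y) \<le> ennreal (P x * W x * Q y + Q x * (P y * W y))"
      by (rule ennreal_leI)
    thus "ennreal (P x) * ennreal (Q y * W y) + ennreal (Q x * W x) * ennreal (P y)
        \<le> ennreal (P x * W x) * ennreal (Q y) + ennreal (Q x) * ennreal (P y * W y)"
      using nonneg[OF xy(1)] nonneg[OF xy(2)] by (simp add: ennreal_mult ennreal_plus)
  qed
  also have "\<dots> = ?PW * ?Q + ?Q * ?PW"
    by (rule double) measurable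
  also have "?P * ?QW + ?QW * ?P = 2 * (?P * ?QW)"
    by (simp add: mult_2 mult.commute)
  also have "?PW * ?Q + ?Q * ?PW = 2 * (?PW * ?Q)"
    by (simp add: mult_2 mult.commute)
  finally show ?thesis
    using ennreal_mult_le_mult_iff[of 2] by simp
qed

section \<open>Power sums and symmetrised monomials of two numbers with fixed sum\<close>

definition two_power_sum :: "nat \<Rightarrow> real \<Rightarrow> real \<Rightarrow> real" where
  "two_power_sum k a b = a ^ k + b ^ k"

lemma two_power_sum_pos: "a > 0 \<Longrightarrow> b > 0 \<Longrightarrow> two_power_sum k a b > 0"
  by (simp add: two_power_sum_def add_pos_pos)

text \<open>Newton's recurrence: \<open>a\<close> and \<open>b\<close> are the roots of
  \<open>z^2 - (a + b) z + ab\<close>. With \<open>a + b\<close> fixed, the product is the only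
  parameter left.\<close>

lemma two_power_sum_rec: "two_power_sum (Suc (Suc k)) a b = (a + b) * two_power_sum (Suc k) a b - a * b * two_power_sum k a b"
  by (simp add: two_power_sum_def algebra_simps)

text \<open>
  For fixed $a + b$ the quotient $S_{k+1} / S_k = (a + b) - ab / (S_k / S_{k-1})$ of consecutive power
  sums decreases in $ab$, by induction.
\<close>
lemma two_power_sum_Suc_quotient_mono:
  assumes "a > 0" "b > 0" "a' > 0" "b' > 0" "a + b = a' + b'" "a * b \<le> a' * b'"
  shows "two_power_sum (Suc k) a' b' * two_power_sum k a b \<le> two_power_sum (Suc k) a b * two_power_sum k a' b'"
proof (induction k)
  case 0
  thus ?case using assms by (simp add: two_power_sum_def)
next
  case (Suc k)
  have "a * b * (two_power_sum k a b * two_power_sum (Suc k) a' b') \<le> a' * b' * (two_power_sum (Suc k) a b * two_power_sum k a' b')"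
    using assms Suc.IH
    by (intro mult_mono[of "a * b"]) (simp_all add: mult_ac less_imp_le two_power_sum_pos)
  thus ?case
    using assms(5) by (simp add: two_power_sum_rec algebra_simps)
qed

text \<open>The quotient of the sums of exponents \<open>l\<close> and \<open>k\<close> is a product
  of consecutive quotients; the induction multiplies on one more of them and cancels the common
  positive factor of exponent \<open>n\<close>.\<close>

lemma two_power_sum_quotient_mono:
  assumes "a > 0" "b > 0" "a' > 0" "b' > 0" "a + b = a' + b'" "a * b \<le> a' * b'" "k \<le> l"
  shows "two_power_sum l a' b' * two_power_sum k a b \<le> two_power_sum l a b * two_power_sum k a' b'"
  using assms(7)
proof (induction l rule: dec_induct)
  case base
  thus ?case by (simp add: mult_ac)
next
  case (step n)
  have "(two_power_sum (Suc n) a' b' * two_power_sum n a b) * (two_power_sum n a' b' * two_power_sum k a b) \<le>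
        (two_power_sum (Suc n) a b * two_power_sum n a' b') * (two_power_sum n a b * two_power_sum k a' b')"
    using two_power_sum_Suc_quotient_mono[OF assms(1-6), of n] step.IH
    by (rule mult_mono) (use assms in \<open>simp_all add: less_imp_le two_power_sum_pos\<close>)
  hence "(two_power_sum (Suc n) a' b' * two_power_sum k a b) * (two_power_sum n a b * two_power_sum n a' b') \<le>
         (two_power_sum (Suc n) a b * two_power_sum k a' b') * (two_power_sum n a b * two_power_sum n a' b')"
    by (simp add: mult_ac)
  thus ?case
    using two_power_sum_pos[OF assms(1,2), of n] two_power_sum_pos[OF assms(3,4), of n] by (simp add: mult_le_cancel_right)
qed

text \<open>A single \<open>a ^ m * b ^ n\<close> is in general not determined by
  \<open>a + b\<close> and \<open>a * b\<close>; the symmetrised one is, so for a fixed sum it can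
  be compared along the product.\<close>

definition sym_monomial :: "nat \<Rightarrow> nat \<Rightarrow> real \<Rightarrow> real \<Rightarrow> real" where
  "sym_monomial m n a b = a ^ m * b ^ n + a ^ n * b ^ m"

lemma sym_monomial_nonneg: "a \<ge> 0 \<Longrightarrow> b \<ge> 0 \<Longrightarrow> sym_monomial m n a b \<ge> 0"
  by (simp add: sym_monomial_def)

lemma sym_monomial_eq: "m \<ge> n \<Longrightarrow> sym_monomial m n a b = (a * b) ^ n * two_power_sum (m - n) a b"
  by (simp add: sym_monomial_def two_power_sum_def algebra_simps power_mult_distrib flip: power_add)

text \<open>With \<open>S_k\<close> the power sums, the quotient of the two monomials is
  \<open>(a * b) ^ (n - q) * S_(m-n) / S_(p-q)\<close>. Both factors increase with the product, the
  second because \<open>m - n \<le> p - q\<close>. Cross-multiplication avoids the division.\<close>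

lemma sym_monomial_quotient_mono:
  assumes ab: "a > 0" "b > 0" "a' > 0" "b' > 0" "a + b = a' + b'" "a * b \<le> a' * b'"
    and "p > m" "m \<ge> n" "n > q" "m + n = p + q"
  shows "sym_monomial m n a b * sym_monomial p q a' b' \<le> sym_monomial m n a' b' * sym_monomial p q a b"
proof -
  have "(a * b) ^ (n - q) * (two_power_sum (p - q) a' b' * two_power_sum (m - n) a b) \<le>
        (a' * b') ^ (n - q) * (two_power_sum (p - q) a b * two_power_sum (m - n) a' b')"
  proof (rule mult_mono)
    show "(a * b) ^ (n - q) \<le> (a' * b') ^ (n - q)"
      using ab by (intro power_mono) auto
    show "two_power_sum (p - q) a' b' * two_power_sum (m - n) a b \<le> two_power_sum (p - q) a b * two_power_sum (m - n) a' b'"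
      by (rule two_power_sum_quotient_mono) (use assms in auto)
  qed (use ab in \<open>simp_all add: less_imp_le two_power_sum_pos\<close>)
  hence le: "((a * b) ^ q * (a' * b') ^ q) * ((a * b) ^ (n - q) * (two_power_sum (p - q) a' b' * two_power_sum (m - n) a b)) \<le>
        ((a * b) ^ q * (a' * b') ^ q) * ((a' * b') ^ (n - q) * (two_power_sum (p - q) a b * two_power_sum (m - n) a' b'))"
    using ab by (intro mult_left_mono) auto
  have "n = q + (n - q)" using assms by simp
  hence split: "(x * y) ^ n = (x * y) ^ q * (x * y) ^ (n - q)" for x y :: real
    by (metis power_add)
  have eq: "sym_monomial m n x y = (x * y) ^ q * (x * y) ^ (n - q) * two_power_sum (m - n) x y" "sym_monomial p q x y = (x * y) ^ q * two_power_sum (p - q) x y" for x y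
    using assms by (simp_all add: sym_monomial_eq flip: split)
  have rearrange: "A * B * S * (A' * T') = (A * A') * (B * (T' * S))"
      "A' * B' * S' * (A * T) = (A * A') * (B' * (T * S'))" for A B S T A' B' S' T' :: real
    by algebra+
  show ?thesis
    using le by (simp only: eq rearrange[where A = "(a * b) ^ q" and A' = "(a' * b') ^ q"])
qed

section \<open>Beta integrals and symmetrised convolutions\<close>

lemma has_integral_Beta_nat:
  fixes t :: real
  assumes "t \<ge> 0"
  shows "((\<lambda>u. u ^ a * (t - u) ^ b) has_integral (fact a * fact b / fact (a + b + 1) * t ^ (a + b + 1))) {0..t}"
proof (induction b arbitrary: a)
  case 0
  have *: "((\<lambda>u. u ^ Suc a / Suc a) has_real_derivative u ^ a) (at u within {0..t})" for u
    using DERIV_cdivide[OF DERIV_pow[of "Suc a" u "{0..t}"], of "real (Suc a)"] by (simp del: of_nat_Suc power_Suc)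
  have "((\<lambda>u. u ^ a) has_integral (t ^ Suc a / Suc a - 0 ^ Suc a / Suc a)) {0..t}"
    using assms
    by (intro fundamental_theorem_of_calculus has_real_derivative_iff_has_vector_derivative[THEN iffD1] *)
  also have "t ^ Suc a / Suc a - 0 ^ Suc a / Suc a = fact a * fact 0 / fact (a + 0 + 1) * t ^ (a + 0 + 1)"
    by (simp add: fact_reduce del: of_nat_Suc)
  finally show ?case by simp
next
  case (Suc b)
  \<comment> \<open>Integration by parts: this function vanishes at both ends of the interval, so
    its derivative has integral 0 and the exponent \<open>Suc b\<close> is traded for
    \<open>Suc a\<close> in the induction hypothesis.\<close>
  have *: "((\<lambda>u. u ^ Suc a * (t - u) ^ Suc b / Suc a) has_real_derivative
      u ^ a * (t - u) ^ Suc b - real (Suc b) / real (Suc a) * (u ^ Suc a * (t - u) ^ b)) (at u within {0..t})" for u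
  proof -
    have 1: "((\<lambda>u. u ^ Suc a) has_real_derivative real (Suc a) * u ^ a) (at u within {0..t})"
      using DERIV_pow[of "Suc a" u "{0..t}"] by simp
    have "((\<lambda>u. t - u) has_real_derivative - 1) (at u within {0..t})"
      by (auto intro!: derivative_eq_intros)
    from DERIV_power[OF this, of "Suc b"]
    have 2: "((\<lambda>u. (t - u) ^ Suc b) has_real_derivative real (Suc b) * (- 1 * (t - u) ^ b)) (at u within {0..t})"
      by (simp only: diff_Suc_Suc diff_zero)
    have "(real (Suc a) * u ^ a * (t - u) ^ Suc b + real (Suc b) * (- 1 * (t - u) ^ b) * u ^ Suc a) / real (Suc a) =
        u ^ a * (t - u) ^ Suc b - real (Suc b) / real (Suc a) * (u ^ Suc a * (t - u) ^ b)"
      by (simp add: add_divide_distrib diff_divide_distrib del: of_nat_Suc power_Suc)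
    with DERIV_cdivide[OF DERIV_mult[OF 1 2], of "real (Suc a)"] show ?thesis
      by (simp only:)
  qed
  have "((\<lambda>u. u ^ a * (t - u) ^ Suc b - real (Suc b) / real (Suc a) * (u ^ Suc a * (t - u) ^ b)) has_integral
      (t ^ Suc a * (t - t) ^ Suc b / Suc a - 0 ^ Suc a * (t - 0) ^ Suc b / Suc a)) {0..t}"
    using assms
    by (intro fundamental_theorem_of_calculus has_real_derivative_iff_has_vector_derivative[THEN iffD1] *)
  also have "t ^ Suc a * (t - t) ^ Suc b / Suc a - 0 ^ Suc a * (t - 0) ^ Suc b / Suc a = 0"
    by simp
  finally have "((\<lambda>u. u ^ a * (t - u) ^ Suc b - real (Suc b) / real (Suc a) * (u ^ Suc a * (t - u) ^ b)) has_integral 0) {0..t}" .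
  from has_integral_add[OF this has_integral_mult_right[OF Suc.IH[of "Suc a"], of "real (Suc b) / real (Suc a)"]]
  have "((\<lambda>u. u ^ a * (t - u) ^ Suc b) has_integral
      real (Suc b) / real (Suc a) * (fact (Suc a) * fact b / fact (Suc a + b + 1) * t ^ (Suc a + b + 1))) {0..t}"
    by (simp only: diff_add_cancel add_0)
  also have "real (Suc b) / real (Suc a) * (fact (Suc a) * fact b / fact (Suc a + b + 1) * t ^ (Suc a + b + 1)) =
      fact a * fact (Suc b) / fact (a + Suc b + 1) * t ^ (a + Suc b + 1)"
  proof -
    have eq: "Suc a + b + 1 = a + Suc b + 1" by simp
    have fact: "fact (Suc a) = real (Suc a) * fact a" "fact (Suc b) = real (Suc b) * fact b"
      by simp_all
    show ?thesis
      unfolding eq unfolding fact by (simp del: of_nat_Suc fact_Suc power_Suc add_Suc_right)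
  qed
  finally show ?case .
qed

lemma nn_integral_Beta_nat:
  fixes t :: real
  assumes "t > 0"
  shows "(\<integral>\<^sup>+u\<in>{0<..<t}. ennreal (u ^ a * (t - u) ^ b) \<partial>lborel) =
           ennreal (fact a * fact b / fact (a + b + 1) * t ^ (a + b + 1))"
proof -
  have "((\<lambda>u. u ^ a * (t - u) ^ b) has_integral (fact a * fact b / fact (a + b + 1) * t ^ (a + b + 1))) {0<..<t}"
    using has_integral_Beta_nat[of t a b] assms by (simp add: has_integral_Icc_iff_Ioo)
  thus ?thesis
    by (intro nn_integral_has_integral_lebesgue') auto
qed

lemma nn_integral_Ioo_reflect:
  fixes f :: "real \<Rightarrow> ennreal"
  assumes [measurable]: "f \<in> borel_measurable borel"
  shows "(\<integral>\<^sup>+u\<in>{0<..<t}. f (t - u) \<partial>lborel) = (\<integral>\<^sup>+u\<in>{0<..<t}. f u \<partial>lborel)"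
proof -
  have "(\<integral>\<^sup>+u\<in>{0<..<t}. f u \<partial>lborel) = (\<integral>\<^sup>+u. f (t + (-1) * u) * indicator {0<..<t} (t + (-1) * u) \<partial>lborel)"
    by (subst nn_integral_real_affine[where c="-1" and t=t]) auto
  also have "\<dots> = (\<integral>\<^sup>+u\<in>{0<..<t}. f (t - u) \<partial>lborel)"
    by (intro nn_integral_cong) (auto simp: indicator_def)
  finally show ?thesis by simp
qed

text \<open>The weight \<open>w u * w (t - u)\<close> is invariant under
  \<open>u \<mapsto> t - u\<close>, which exchanges the two monomials; hence both halves contribute
  the same convolution.\<close>

lemma nn_integral_sym_monomial:
  fixes w :: "real \<Rightarrow> real"
  assumes [measurable]: "w \<in> borel_measurable borel" and w: "\<And>u. u > 0 \<Longrightarrow> w u \<ge> 0"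
  shows "(\<integral>\<^sup>+u\<in>{0<..<t}. ennreal (sym_monomial m n u (t - u) * (w u * w (t - u))) \<partial>lborel) =
     2 * half_line_conv (\<lambda>u. ennreal (u ^ m * w u)) (\<lambda>u. ennreal (u ^ n * w u)) t"
proof -
  let ?f = "\<lambda>u. ennreal (u ^ m * w u) * ennreal ((t - u) ^ n * w (t - u))"
  have "(\<integral>\<^sup>+u\<in>{0<..<t}. ennreal (sym_monomial m n u (t - u) * (w u * w (t - u))) \<partial>lborel) =
        (\<integral>\<^sup>+u. ?f u * indicator {0<..<t} u + ?f (t - u) * indicator {0<..<t} u \<partial>lborel)"
  proof (rule nn_integral_cong)
    fix u :: real
    show "ennreal (sym_monomial m n u (t - u) * (w u * w (t - u))) * indicator {0<..<t} u =
       ?f u * indicator {0<..<t} u + ?f (t - u) * indicator {0<..<t} u"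
    proof (cases "u \<in> {0<..<t}")
      case True
      hence "w u \<ge> 0" "w (t - u) \<ge> 0" "u > 0" "t - u > 0" by (auto intro!: w)
      thus ?thesis using True
        by (simp add: sym_monomial_def ennreal_mult'[symmetric] ennreal_plus[symmetric] del: ennreal_plus)
           (simp add: algebra_simps)
    qed auto
  qed
  also have "\<dots> = (\<integral>\<^sup>+u\<in>{0<..<t}. ?f u \<partial>lborel) + (\<integral>\<^sup>+u\<in>{0<..<t}. ?f (t - u) \<partial>lborel)"
    by (rule nn_integral_add) measurable
  also have "(\<integral>\<^sup>+u\<in>{0<..<t}. ?f (t - u) \<partial>lborel) = (\<integral>\<^sup>+u\<in>{0<..<t}. ?f u \<partial>lborel)"
    by (rule nn_integral_Ioo_reflect) measurable
  finally show ?thesis by (simp add: half_line_conv_def mult_2)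
qed

text \<open>Completing the square: \<open>u * (t - u) = t^2 / 4 - (u - t / 2)^2\<close>.\<close>

lemma product_le_product_iff_dist_half:
  fixes u v t :: real
  shows "u * (t - u) \<le> v * (t - v) \<longleftrightarrow> \<bar>v - t / 2\<bar> \<le> \<bar>u - t / 2\<bar>"
proof -
  have "u * (t - u) \<le> v * (t - v) \<longleftrightarrow> (v - t / 2)\<^sup>2 \<le> (u - t / 2)\<^sup>2"
    by (simp add: power2_eq_square algebra_simps)
  thus ?thesis by (simp add: abs_le_square_iff)
qed

text \<open>A larger product means that \<open>v\<close> is nearer to the midpoint, so
  \<open>v\<close> and \<open>t - v\<close> lie between \<open>u\<close> and \<open>t - u\<close>.
  The case distinction finds the smaller of the outer points. \<open>R\<close> stands for either
  direction of the inequality.\<close>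

lemma weight_mono_product:
  fixes w :: "real \<Rightarrow> real"
  assumes maj: "\<And>a b a' b'. 0 < a \<Longrightarrow> a \<le> a' \<Longrightarrow> a' \<le> b \<Longrightarrow> a + b = a' + b' \<Longrightarrow> R (w a * w b) (w a' * w b')"
    and uv: "0 < u" "u < t" "0 < v" "v < t" "u * (t - u) \<le> v * (t - v)"
  shows "R (w u * w (t - u)) (w v * w (t - v))"
proof (cases "u \<le> t / 2")
  case True
  thus ?thesis
    using uv by (intro maj) (auto simp: product_le_product_iff_dist_half abs_if split: if_splits)
next
  case False
  hence "R (w (t - u) * w u) (w v * w (t - v))"
    using uv by (intro maj) (auto simp: product_le_product_iff_dist_half abs_if split: if_splits)
  thus ?thesis by (simp add: mult.commute)
qed

section \<open>Comparison of convolutions of powers times a common weight\<close>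

context
  fixes w :: "real \<Rightarrow> real" and p m n q :: nat and t :: real
  assumes w_meas [measurable]: "w \<in> borel_measurable borel"
    and w_nonneg: "\<And>u. u > 0 \<Longrightarrow> w u \<ge> 0"
    and pmnq: "p > m" "m \<ge> n" "n > q" "m + n = p + q"
    and t: "t > 0"
begin

text \<open>The indicators are built in so that Chebyshev's inequality can be used for Lebesgue
  measure on the line: as soon as one point leaves the interval, the comonotonicity expression is
  0.\<close>

private definition "P i j u = indicator {0<..<t} u * sym_monomial i j u (t - u)"
private definition "W u = indicator {0<..<t} u * (w u * w (t - u))"

private lemma meas [measurable]: "P i j \<in> borel_measurable borel" "W \<in> borel_measurable borel"
  unfolding P_def W_def sym_monomial_def by measurable

private lemma nn_P: "(\<integral>\<^sup>+u. P i j u \<partial>lborel) = ennreal (2 * fact i * fact j / fact (i + j + 1) * t ^ (i + j + 1))"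
proof -
  have "(\<integral>\<^sup>+u. P i j u \<partial>lborel) = (\<integral>\<^sup>+u\<in>{0<..<t}. ennreal (sym_monomial i j u (t - u) * (1 * 1)) \<partial>lborel)"
    by (intro nn_integral_cong) (auto simp: P_def indicator_def)
  also have "\<dots> = 2 * half_line_conv (\<lambda>u. ennreal (u ^ i * 1)) (\<lambda>u. ennreal (u ^ j * 1)) t"
    by (rule nn_integral_sym_monomial) auto
  also have "half_line_conv (\<lambda>u. ennreal (u ^ i * 1)) (\<lambda>u. ennreal (u ^ j * 1)) t =
     (\<integral>\<^sup>+u\<in>{0<..<t}. ennreal (u ^ i * (t - u) ^ j) \<partial>lborel)"
    unfolding half_line_conv_def by (intro nn_integral_cong) (auto simp: indicator_def ennreal_mult')
  also have "\<dots> = ennreal (fact i * fact j / fact (i + j + 1) * t ^ (i + j + 1))"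
    using t by (rule nn_integral_Beta_nat)
  also have "2 * \<dots> = ennreal (2 * (fact i * fact j / fact (i + j + 1) * t ^ (i + j + 1)))"
    using t by (subst ennreal_mult) auto
  finally show ?thesis by (simp add: mult_ac)
qed

private lemma nn_PW: "(\<integral>\<^sup>+u. P i j u * W u \<partial>lborel) = 2 * half_line_conv (\<lambda>u. ennreal (u ^ i * w u)) (\<lambda>u. ennreal (u ^ j * w u)) t"
proof -
  have "(\<integral>\<^sup>+u. P i j u * W u \<partial>lborel) = (\<integral>\<^sup>+u\<in>{0<..<t}. ennreal (sym_monomial i j u (t - u) * (w u * w (t - u))) \<partial>lborel)"
    by (intro nn_integral_cong) (auto simp: P_def W_def indicator_def)
  thus ?thesis using nn_integral_sym_monomial[OF w_meas w_nonneg] by simp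
qed

private lemma P_nonneg: "P i j u \<ge> 0" and W_nonneg: "W u \<ge> 0"
  by (auto simp: P_def W_def indicator_def sym_monomial_nonneg w_nonneg)

private lemma P_mono:
  assumes "u \<in> {0<..<t}" "v \<in> {0<..<t}" "u * (t - u) \<le> v * (t - v)"
  shows "P m n u * P p q v - P p q u * P m n v \<le> 0"
  using sym_monomial_quotient_mono[of u "t - u" v "t - v" m p n q] assms pmnq by (simp add: P_def mult_ac)

text \<open>Since \<open>k + l = i + j\<close>, the two Beta integrals share the factor
  \<open>T\<close>, and only the quotient of factorials remains after cancellation. The index pairs
  are left free because the two monotonicity cases use them in opposite roles.\<close>

private lemma nn_PW_Chebyshev:
  assumes "\<And>u v. (P i j u * P k l v - P k l u * P i j v) * (W u - W v) \<ge> 0" and N: "k + l = i + j"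
  shows "ennreal (fact i * fact j / (fact k * fact l)) * half_line_conv (\<lambda>u. ennreal (u ^ k * w u)) (\<lambda>u. ennreal (u ^ l * w u)) t
       \<le> half_line_conv (\<lambda>u. ennreal (u ^ i * w u)) (\<lambda>u. ennreal (u ^ j * w u)) t"
proof -
  let ?A = "half_line_conv (\<lambda>u. ennreal (u ^ k * w u)) (\<lambda>u. ennreal (u ^ l * w u)) t"
  let ?B = "half_line_conv (\<lambda>u. ennreal (u ^ i * w u)) (\<lambda>u. ennreal (u ^ j * w u)) t"
  define T where "T = 2 / fact (i + j + 1) * t ^ (i + j + 1)"
  have T: "T > 0" using t by (simp add: T_def)
  have scale: "ennreal a * (ennreal b * (2 * X)) = ennreal (a * b * 2) * X" if "a \<ge> 0" "b \<ge> 0" for a b X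
    using that by (simp add: ennreal_mult mult_ac)
  have "ennreal (fact i * fact j * T) * (2 * ?A) \<le> (2 * ?B) * ennreal (fact k * fact l * T)"
    using nn_Chebyshev[of "P i j" lborel "P k l" W] assms
    unfolding nn_PW nn_P N by (simp add: P_nonneg W_nonneg T_def field_simps)
  hence "ennreal (1 / (2 * fact k * fact l * T)) * (ennreal (fact i * fact j * T) * (2 * ?A))
      \<le> ennreal (1 / (2 * fact k * fact l * T)) * ((2 * ?B) * ennreal (fact k * fact l * T))"
    by (rule mult_left_mono) simp
  also have "ennreal (1 / (2 * fact k * fact l * T)) * (ennreal (fact i * fact j * T) * (2 * ?A)) =
      ennreal (1 / (2 * fact k * fact l * T) * (fact i * fact j * T) * 2) * ?A"
    using T by (intro scale) auto
  also have "1 / (2 * fact k * fact l * T) * (fact i * fact j * T) * 2 = fact i * fact j / (fact k * fact l)"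
    using T by simp
  also have "ennreal (1 / (2 * fact k * fact l * T)) * ((2 * ?B) * ennreal (fact k * fact l * T)) =
      ennreal (1 / (2 * fact k * fact l * T) * (fact k * fact l * T) * 2) * ?B"
    using T by (subst mult.commute[of "2 * ?B"], intro scale) auto
  also have "1 / (2 * fact k * fact l * T) * (fact k * fact l * T) * 2 = 1"
    using T by simp
  finally show ?thesis by simp
qed

text \<open>Here \<open>P m n / P p q\<close> and \<open>W\<close> both increase with
  \<open>u * (t - u)\<close>, so the two factors in the comonotonicity condition always have the
  same sign.\<close>

lemma half_line_conv_power_weight_ge:
  assumes maj: "\<And>a b a' b'. 0 < a \<Longrightarrow> a \<le> a' \<Longrightarrow> a' \<le> b \<Longrightarrow> a + b = a' + b' \<Longrightarrow> w a * w b \<le> w a' * w b'"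
  shows "ennreal (fact m * fact n / (fact p * fact q)) * half_line_conv (\<lambda>u. ennreal (u ^ p * w u)) (\<lambda>u. ennreal (u ^ q * w u)) t
       \<le> half_line_conv (\<lambda>u. ennreal (u ^ m * w u)) (\<lambda>u. ennreal (u ^ n * w u)) t"
proof (rule nn_PW_Chebyshev)
  fix u v
  show "(P m n u * P p q v - P p q u * P m n v) * (W u - W v) \<ge> 0"
  proof (cases "u \<in> {0<..<t} \<and> v \<in> {0<..<t}")
    case uv: True
    have W: "W u \<le> W v" if "u \<in> {0<..<t}" "v \<in> {0<..<t}" "u * (t - u) \<le> v * (t - v)" for u v
      using weight_mono_product[of "(\<le>)" w u t v] maj that by (simp add: W_def)
    show ?thesis
    proof (cases "u * (t - u) \<le> v * (t - v)")
      case True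
      thus ?thesis using P_mono[of u v] W[of u v] uv by (intro mult_nonpos_nonpos) auto
    next
      case False
      thus ?thesis using P_mono[of v u] W[of v u] uv by (intro mult_nonneg_nonneg) (auto simp: mult_ac)
    qed
  qed (auto simp: P_def)
qed (use pmnq in simp)

text \<open>Now \<open>W\<close> decreases with \<open>u * (t - u)\<close>, as does
  \<open>P p q / P m n\<close>; Chebyshev is used with the pairs exchanged, and the constant is
  moved to the other side afterwards.\<close>

lemma half_line_conv_power_weight_le:
  assumes maj: "\<And>a b a' b'. 0 < a \<Longrightarrow> a \<le> a' \<Longrightarrow> a' \<le> b \<Longrightarrow> a + b = a' + b' \<Longrightarrow> w a' * w b' \<le> w a * w b"
  shows "half_line_conv (\<lambda>u. ennreal (u ^ m * w u)) (\<lambda>u. ennreal (u ^ n * w u)) t \<le>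
     ennreal (fact m * fact n / (fact p * fact q)) * half_line_conv (\<lambda>u. ennreal (u ^ p * w u)) (\<lambda>u. ennreal (u ^ q * w u)) t"
proof -
  let ?A = "half_line_conv (\<lambda>u. ennreal (u ^ m * w u)) (\<lambda>u. ennreal (u ^ n * w u)) t"
  have "ennreal (fact p * fact q / (fact m * fact n)) * ?A \<le> half_line_conv (\<lambda>u. ennreal (u ^ p * w u)) (\<lambda>u. ennreal (u ^ q * w u)) t"
  proof (rule nn_PW_Chebyshev)
    fix u v
    show "(P p q u * P m n v - P m n u * P p q v) * (W u - W v) \<ge> 0"
    proof (cases "u \<in> {0<..<t} \<and> v \<in> {0<..<t}")
      case uv: True
      have W: "W v \<le> W u" if "u \<in> {0<..<t}" "v \<in> {0<..<t}" "u * (t - u) \<le> v * (t - v)" for u v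
        using weight_mono_product[of "(\<ge>)" w u t v] maj that by (simp add: W_def)
      show ?thesis
      proof (cases "u * (t - u) \<le> v * (t - v)")
        case True
        thus ?thesis using P_mono[of u v] W[of u v] uv by (intro mult_nonneg_nonneg) auto
      next
        case False
        thus ?thesis using P_mono[of v u] W[of v u] uv by (intro mult_nonpos_nonpos) (auto simp: mult_ac)
      qed
    qed (auto simp: P_def)
  qed (use pmnq in simp)
  hence "ennreal (fact m * fact n / (fact p * fact q)) * (ennreal (fact p * fact q / (fact m * fact n)) * ?A) \<le>
     ennreal (fact m * fact n / (fact p * fact q)) * half_line_conv (\<lambda>u. ennreal (u ^ p * w u)) (\<lambda>u. ennreal (u ^ q * w u)) t"
    by (rule mult_left_mono) simp
  thus ?thesis
    by (simp flip: mult.assoc ennreal_mult')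
qed

end

subsection \<open>Asymptotics and necessity\<close>

text \<open>Laplace transform of the bound \<open>delta_kernel c t \<le> 1 + t\<close>.\<close>

lemma delta_psi_Suc_le:
  assumes c: "c > 0" and x: "x > 0"
  shows "delta_psi c (Suc m) x \<le> fact m / x ^ Suc m + fact (Suc m) / x ^ Suc (Suc m)"
proof -
  have "ennreal (delta_psi c (Suc m) x) = (\<integral>\<^sup>+t\<in>{0<..}. ennreal (t ^ m * delta_kernel c t * exp (- x * t)) \<partial>lborel)"
    by (rule delta_psi_Suc_integral[OF c x])
  also have "\<dots> \<le> (\<integral>\<^sup>+t. ennreal (t ^ m * exp (- x * t)) * indicator {0<..} t
        + ennreal (t ^ Suc m * exp (- x * t)) * indicator {0<..} t \<partial>lborel)"
  proof (rule nn_integral_mono)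
    fix t :: real
    have "t ^ m * delta_kernel c t * exp (- x * t) \<le> t ^ m * exp (- x * t) + t ^ Suc m * exp (- x * t)" if "t > 0"
    proof -
      have "t ^ m * exp (- x * t) * delta_kernel c t \<le> t ^ m * exp (- x * t) * (1 + t)"
        using delta_kernel_bounds(2)[OF c that] that by (intro mult_left_mono) auto
      thus ?thesis by (simp add: algebra_simps)
    qed
    thus "ennreal (t ^ m * delta_kernel c t * exp (- x * t)) * indicator {0<..} t \<le>
       ennreal (t ^ m * exp (- x * t)) * indicator {0<..} t + ennreal (t ^ Suc m * exp (- x * t)) * indicator {0<..} t"
      by (cases "t > 0") (auto simp flip: ennreal_plus intro!: ennreal_leI)
  qed
  also have "\<dots> = (\<integral>\<^sup>+t\<in>{0<..}. ennreal (t ^ m * exp (- x * t)) \<partial>lborel)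
      + (\<integral>\<^sup>+t\<in>{0<..}. ennreal (t ^ Suc m * exp (- x * t)) \<partial>lborel)"
    by (rule nn_integral_add) auto
  also have "\<dots> = ennreal (fact m / x ^ Suc m + fact (Suc m) / x ^ Suc (Suc m))"
    unfolding nn_integral_power_exp[OF x] using x by (intro ennreal_plus[symmetric]) auto
  finally show ?thesis
    using x by (subst (asm) ennreal_le_iff) auto
qed

text \<open>Laplace transform of \<open>1 \<le> delta_kernel c t + c * t\<close>; the subtraction is
  avoided so that every integrand is nonnegative.\<close>

lemma delta_psi_Suc_ge:
  assumes c: "c > 0" and x: "x > 0"
  shows "fact m / x ^ Suc m \<le> delta_psi c (Suc m) x + c * (fact (Suc m) / x ^ Suc (Suc m))"
proof -
  have "ennreal (fact m / x ^ Suc m) = (\<integral>\<^sup>+t\<in>{0<..}. ennreal (t ^ m * exp (- x * t)) \<partial>lborel)"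
    by (rule nn_integral_power_exp[OF x, symmetric])
  also have "\<dots> \<le> (\<integral>\<^sup>+t. ennreal (t ^ m * delta_kernel c t * exp (- x * t)) * indicator {0<..} t
        + ennreal c * (ennreal (t ^ Suc m * exp (- x * t)) * indicator {0<..} t) \<partial>lborel)"
  proof (rule nn_integral_mono)
    fix t :: real
    have "t ^ m * exp (- x * t) \<le> t ^ m * delta_kernel c t * exp (- x * t) + c * (t ^ Suc m * exp (- x * t))"
      "t ^ m * delta_kernel c t * exp (- x * t) \<ge> 0" if "t > 0"
    proof -
      have "t ^ m * exp (- x * t) * 1 \<le> t ^ m * exp (- x * t) * (delta_kernel c t + c * t)"
        using delta_kernel_bounds(1)[OF c that] that by (intro mult_left_mono) auto
      thus "t ^ m * exp (- x * t) \<le> t ^ m * delta_kernel c t * exp (- x * t) + c * (t ^ Suc m * exp (- x * t))"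
        by (simp add: algebra_simps)
      show "t ^ m * delta_kernel c t * exp (- x * t) \<ge> 0"
        using delta_kernel_pos[OF c that] that by simp
    qed
    thus "ennreal (t ^ m * exp (- x * t)) * indicator {0<..} t \<le>
       ennreal (t ^ m * delta_kernel c t * exp (- x * t)) * indicator {0<..} t +
       ennreal c * (ennreal (t ^ Suc m * exp (- x * t)) * indicator {0<..} t)"
      using c by (cases "t > 0") (auto simp flip: ennreal_plus ennreal_mult intro!: ennreal_leI)
  qed
  also have "\<dots> = (\<integral>\<^sup>+t\<in>{0<..}. ennreal (t ^ m * delta_kernel c t * exp (- x * t)) \<partial>lborel)
      + ennreal c * (\<integral>\<^sup>+t\<in>{0<..}. ennreal (t ^ Suc m * exp (- x * t)) \<partial>lborel)"
    by (subst nn_integral_add) (auto simp del: power_Suc intro!: nn_integral_cmult)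
  also have "\<dots> = ennreal (delta_psi c (Suc m) x + c * (fact (Suc m) / x ^ Suc (Suc m)))"
    unfolding nn_integral_power_exp[OF x] delta_psi_Suc_integral[OF c x, symmetric] ennreal_mult'[OF less_imp_le[OF c], symmetric]
    using x c delta_psi_Suc_nonneg[OF c x, of m] by (intro ennreal_plus[symmetric]) auto
  finally show ?thesis
    using x c delta_psi_Suc_nonneg[OF c x, of m] by (subst (asm) ennreal_le_iff) auto
qed

text \<open>For \<open>m = 0\<close> the truncated \<open>m - 1\<close> is 0, and the limit 1 agrees
  with \<open>delta_psi_0\<close>; so no separate case for \<open>q = 0\<close> arises in the limit
  of \<open>F\<close>.\<close>

lemma delta_psi_at_top:
  assumes c: "c > 0"
  shows "((\<lambda>x. x ^ m * delta_psi c m x) \<longlongrightarrow> fact (m - 1)) at_top"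
proof (cases m)
  case 0
  thus ?thesis using c by (simp add: delta_psi_0)
next
  case (Suc k)
  have "((\<lambda>x. x ^ Suc k * delta_psi c (Suc k) x) \<longlongrightarrow> fact k) at_top"
  proof (rule tendsto_sandwich)
    show "eventually (\<lambda>x. fact k - c * fact (Suc k) * (1 / x) \<le> x ^ Suc k * delta_psi c (Suc k) x) at_top"
      using eventually_gt_at_top[of 0]
    proof eventually_elim
      case (elim x)
      have "x ^ Suc k * (fact k / x ^ Suc k) \<le> x ^ Suc k * (delta_psi c (Suc k) x + c * (fact (Suc k) / x ^ Suc (Suc k)))"
        using elim by (intro mult_left_mono delta_psi_Suc_ge c) auto
      also have "x ^ Suc k * (fact k / x ^ Suc k) = fact k"
        using elim by simp
      also have "x ^ Suc k * (delta_psi c (Suc k) x + c * (fact (Suc k) / x ^ Suc (Suc k))) =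
          x ^ Suc k * delta_psi c (Suc k) x + c * fact (Suc k) * (1 / x)"
        using elim by (simp add: distrib_left power_Suc[of x "Suc k"] del: fact_Suc power_Suc)
      finally show ?case by simp
    qed
    show "eventually (\<lambda>x. x ^ Suc k * delta_psi c (Suc k) x \<le> fact k + fact (Suc k) * (1 / x)) at_top"
      using eventually_gt_at_top[of 0]
    proof eventually_elim
      case (elim x)
      have "x ^ Suc k * delta_psi c (Suc k) x \<le> x ^ Suc k * (fact k / x ^ Suc k + fact (Suc k) / x ^ Suc (Suc k))"
        using elim by (intro mult_left_mono delta_psi_Suc_le c) auto
      also have "\<dots> = fact k + fact (Suc k) * (1 / x)"
        using elim by (simp add: distrib_left power_Suc[of x "Suc k"] del: fact_Suc power_Suc)
      finally show ?case .
    qed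
    have inv: "((\<lambda>x::real. 1 / x) \<longlongrightarrow> 0) at_top" by real_asymp
    from tendsto_diff[OF tendsto_const[of "fact k"] tendsto_mult[OF tendsto_const[of "c * fact (Suc k)"] inv]]
    show "((\<lambda>x. fact k - c * fact (Suc k) * (1 / x)) \<longlongrightarrow> fact k) at_top" by simp
    from tendsto_add[OF tendsto_const[of "fact k"] tendsto_mult[OF tendsto_const[of "fact (Suc k)"] inv]]
    show "((\<lambda>x::real. fact k + fact (Suc k) * (1 / x)) \<longlongrightarrow> fact k) at_top" by simp
  qed
  thus ?thesis using Suc by simp
qed

text \<open>The functional equation of the polygamma functions isolates the pole at 0: the first
  summand is regular there, and so is the term with \<open>x + c\<close>.\<close>

lemma delta_psi_Suc_plus1:
  assumes c: "c > 0" and x: "x > 0"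
  shows "delta_psi c (Suc m) x = delta_psi c (Suc m) (x + 1) + fact m / c * (1 / x ^ Suc m - 1 / (x + c) ^ Suc m)"
proof -
  have P: "Polygamma m (y + 1) = Polygamma m y + (- 1) ^ m * fact m / y ^ Suc m" if "y > 0" for y :: real
    using that by (intro Polygamma_plus1) auto
  have "x + 1 + c = (x + c) + 1" by simp
  hence *: "Polygamma m (x + 1 + c) = Polygamma m (x + c) + (- 1) ^ m * fact m / (x + c) ^ Suc m"
    unfolding \<open>x + 1 + c = (x + c) + 1\<close> using c x by (intro P) simp
  have "(- 1) ^ m * (- 1) ^ m = (1 :: real)" by (simp flip: power_mult_distrib)
  thus ?thesis
    unfolding delta_psi_def Delta_def psi_pred.simps * P[OF x]
    by (simp add: diff_divide_distrib add_divide_distrib algebra_simps)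
qed

lemma delta_psi_Suc_at_0:
  assumes c: "c > 0"
  shows "((\<lambda>x. x ^ Suc m * delta_psi c (Suc m) x) \<longlongrightarrow> fact m / c) (at_right 0)"
proof -
  have "isCont (delta_psi c (Suc m)) 1"
    using delta_psi_Suc_has_derivative[OF c, of 1 m] by (intro DERIV_isCont) auto
  moreover have "((\<lambda>x::real. x + 1) \<longlongrightarrow> 1) (at_right 0)"
    by real_asymp
  ultimately have cont: "((\<lambda>x. delta_psi c (Suc m) (x + 1)) \<longlongrightarrow> delta_psi c (Suc m) 1) (at_right 0)"
    by (rule isCont_tendsto_compose)
  have pow: "((\<lambda>x::real. x ^ Suc m) \<longlongrightarrow> 0 ^ Suc m) (at_right 0)"
    by (intro tendsto_intros)
  have "((\<lambda>x. 1 / (x + c) ^ Suc m) \<longlongrightarrow> 1 / (0 + c) ^ Suc m) (at_right 0)"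
    using c by (intro tendsto_intros) auto
  hence "((\<lambda>x. x ^ Suc m * delta_psi c (Suc m) (x + 1) + fact m / c * (1 - x ^ Suc m * (1 / (x + c) ^ Suc m))) \<longlongrightarrow>
      0 ^ Suc m * delta_psi c (Suc m) 1 + fact m / c * (1 - 0 ^ Suc m * (1 / (0 + c) ^ Suc m))) (at_right 0)"
    by (intro tendsto_add tendsto_mult tendsto_diff tendsto_const cont pow)
  also have "0 ^ Suc m * delta_psi c (Suc m) 1 + fact m / c * (1 - 0 ^ Suc m * (1 / (0 + c) ^ Suc m)) = fact m / c"
    by simp
  finally show ?thesis
  proof (rule Lim_transform_eventually)
    show "eventually (\<lambda>x. x ^ Suc m * delta_psi c (Suc m) (x + 1) + fact m / c * (1 - x ^ Suc m * (1 / (x + c) ^ Suc m)) =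
        x ^ Suc m * delta_psi c (Suc m) x) (at_right 0)"
      using eventually_at_right_less[of 0]
    proof eventually_elim
      case (elim x)
      have "X * R + K * (1 - X * Q) = X * (R + K * (1 / X - Q))" if "X > 0" for X R K Q :: real
        using that by (simp add: field_simps)
      from this[of "x ^ Suc m"] show ?case
        unfolding delta_psi_Suc_plus1[OF c elim, of m] using elim by (simp only: zero_less_power)
    qed
  qed
qed

text \<open>As \<open>m + n = p + q\<close>, a single power of \<open>x\<close> normalises both
  products.\<close>

lemma F_at_top:
  assumes c: "c > 0" and "m + n = p + q"
  shows "((\<lambda>x. x ^ (m + n) * F p m n q x s c) \<longlongrightarrow>
           fact (m - 1) * fact (n - 1) - s * (fact (p - 1) * fact (q - 1))) at_top"
proof -
  have "((\<lambda>x. (x ^ m * delta_psi c m x) * (x ^ n * delta_psi c n x) - s * ((x ^ p * delta_psi c p x) * (x ^ q * delta_psi c q x))) \<longlongrightarrow>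
      fact (m - 1) * fact (n - 1) - s * (fact (p - 1) * fact (q - 1))) at_top"
    by (intro tendsto_intros delta_psi_at_top c)
  moreover have "(x ^ m * delta_psi c m x) * (x ^ n * delta_psi c n x) - s * ((x ^ p * delta_psi c p x) * (x ^ q * delta_psi c q x))
     = x ^ (m + n) * F p m n q x s c" for x
  proof -
    have "x ^ m * x ^ n = x ^ p * x ^ q"
      using assms(2) by (simp flip: power_add)
    moreover have "A * P * (B * Q) - s * (C * R * (D * S)) = A * B * (P * Q) - s * (C * D * (R * S))"
      for A B C D P Q R S :: real by algebra
    ultimately show ?thesis
      unfolding F_eq_delta_psi right_diff_distrib power_add by (simp only: mult.left_commute[of _ s])
  qed
  ultimately show ?thesis by simp
qed

text \<open>The product of two functions of positive index yields \<open>1 / c\<close> twice, the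
  other product only once because its second factor is constantly 1. This imbalance is the source of
  the threshold with \<open>/ c\<close>.\<close>

lemma F_at_0:
  assumes c: "c > 0" and "m \<ge> 1" "n \<ge> 1"
  shows "((\<lambda>x. x ^ (m + n) * F (m + n) m n 0 x s c) \<longlongrightarrow>
           (fact (m - 1) / c) * (fact (n - 1) / c) - s * (fact (m + n - 1) / c)) (at_right 0)"
proof -
  obtain m' n' where mn: "m = Suc m'" "n = Suc n'" using assms by (metis Suc_le_D One_nat_def)
  have "((\<lambda>x. (x ^ m * delta_psi c m x) * (x ^ n * delta_psi c n x) - s * (x ^ (m + n) * delta_psi c (m + n) x)) \<longlongrightarrow>
      (fact (m - 1) / c) * (fact (n - 1) / c) - s * (fact (m + n - 1) / c)) (at_right 0)"
    using delta_psi_Suc_at_0[OF c, of m'] delta_psi_Suc_at_0[OF c, of n'] delta_psi_Suc_at_0[OF c, of "m' + n"]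
    unfolding mn by (intro tendsto_intros) simp_all
  moreover have "(x ^ m * delta_psi c m x) * (x ^ n * delta_psi c n x) - s * (x ^ (m + n) * delta_psi c (m + n) x)
     = x ^ (m + n) * F (m + n) m n 0 x s c" for x
    unfolding F_eq_delta_psi delta_psi_0[OF c] by (simp add: power_add algebra_simps)
  ultimately show ?thesis by simp
qed

text \<open>Truncated subtraction makes \<open>fact (0 - 1) = 1\<close>, so the case
  \<open>q = 0\<close> is covered by the general formula.\<close>

lemma alpha_eq: "alpha p m n q = fact (m - 1) * fact (n - 1) / (fact (p - 1) * fact (q - 1))"
  by (simp add: alpha_def)

lemma alpha_pos: "alpha p m n q > 0"
  by (simp add: alpha_eq)

text \<open>Necessity rests on the sign of \<open>F\<close> alone: the limit of \<open>F\<close>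
  times a positive power of \<open>x\<close> keeps that sign and is affine in
  \<open>s\<close>.\<close>

lemma F_nonneg_imp_le_alpha:
  assumes "c > 0" "m + n = p + q" "\<And>x. x > 0 \<Longrightarrow> F p m n q x s c \<ge> 0"
  shows "s \<le> alpha p m n q"
proof -
  have "0 \<le> fact (m - 1) * fact (n - 1) - s * (fact (p - 1) * fact (q - 1))"
    by (rule tendsto_lowerbound[OF F_at_top[OF assms(1,2)]])
       (use assms(3) in \<open>auto intro!: eventually_mono[OF eventually_gt_at_top[of 0]]\<close>)
  thus ?thesis by (simp add: alpha_eq field_simps)
qed

lemma F_nonpos_imp_ge_alpha:
  assumes "c > 0" "m + n = p + q" "\<And>x. x > 0 \<Longrightarrow> F p m n q x s c \<le> 0"
  shows "s \<ge> alpha p m n q"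
proof -
  have "0 \<ge> fact (m - 1) * fact (n - 1) - s * (fact (p - 1) * fact (q - 1))"
    by (rule tendsto_upperbound[OF F_at_top[OF assms(1,2)]])
       (use assms(3) in \<open>auto intro!: eventually_mono[OF eventually_gt_at_top[of 0]] mult_nonneg_nonpos\<close>)
  thus ?thesis by (simp add: alpha_eq field_simps)
qed

lemma F0_nonneg_imp_le_alpha:
  assumes "c > 0" "m \<ge> 1" "n \<ge> 1" "\<And>x. x > 0 \<Longrightarrow> F (m + n) m n 0 x s c \<ge> 0"
  shows "s \<le> alpha (m + n) m n 0 / c"
proof -
  have "0 \<le> (fact (m - 1) / c) * (fact (n - 1) / c) - s * (fact (m + n - 1) / c)"
    by (rule tendsto_lowerbound[OF F_at_0[OF assms(1-3)]])
       (use assms(4) in \<open>auto intro!: eventually_mono[OF eventually_at_right_less[of 0]]\<close>)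
  thus ?thesis using assms(1) by (simp add: alpha_eq field_simps)
qed

lemma F0_nonpos_imp_ge_alpha:
  assumes "c > 0" "m \<ge> 1" "n \<ge> 1" "\<And>x. x > 0 \<Longrightarrow> F (m + n) m n 0 x s c \<le> 0"
  shows "s \<ge> alpha (m + n) m n 0 / c"
proof -
  have "0 \<ge> (fact (m - 1) / c) * (fact (n - 1) / c) - s * (fact (m + n - 1) / c)"
    by (rule tendsto_upperbound[OF F_at_0[OF assms(1-3)]])
       (use assms(4) in \<open>auto intro!: eventually_mono[OF eventually_at_right_less[of 0]] mult_nonneg_nonpos\<close>)
  thus ?thesis using assms(1) by (simp add: alpha_eq field_simps)
qed

subsection \<open>Sufficiency\<close>

lemma delta_kernel_majorization_concave:
  assumes c: "0 < c" "c \<le> 1" and ab: "0 < a" "a \<le> a'" "a' \<le> b" "a + b = a' + b'"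
  shows "delta_kernel c a * delta_kernel c b \<le> delta_kernel c a' * delta_kernel c b'"
proof -
  have pos: "delta_kernel c a > 0" "delta_kernel c b > 0" "delta_kernel c a' > 0" "delta_kernel c b' > 0"
    using c ab by (auto intro!: delta_kernel_pos)
  have "inverse (delta_kernel c a') * inverse (delta_kernel c b') \<le> inverse (delta_kernel c a) * inverse (delta_kernel c b)"
    by (rule majorization_from_ln[OF _ delta_kernel_log_concave[OF c] ab]) (simp add: c delta_kernel_pos)
  hence "inverse (delta_kernel c a' * delta_kernel c b') \<le> inverse (delta_kernel c a * delta_kernel c b)"
    by (simp only: inverse_mult_distrib)
  thus ?thesis using pos by (subst (asm) inverse_le_iff_le) auto
qed

lemma delta_kernel_majorization_convex:
  assumes c: "c \<ge> 1" and ab: "0 < a" "a \<le> a'" "a' \<le> b" "a + b = a' + b'"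
  shows "delta_kernel c a' * delta_kernel c b' \<le> delta_kernel c a * delta_kernel c b"
  by (rule majorization_from_ln[OF _ delta_kernel_log_convex[OF c] ab]) (use c in \<open>simp add: delta_kernel_pos\<close>)

lemma delta_kernel_mult_tendsto:
  assumes c: "c > 0" and t: "t > 0"
  shows "((\<lambda>a. delta_kernel c a * delta_kernel c (t - a)) \<longlongrightarrow> delta_kernel c t) (at_right 0)"
proof -
  have "isCont (delta_kernel c) t"
    unfolding delta_kernel_def using c t by (intro continuous_intros) auto
  moreover have "((\<lambda>a. t - a) \<longlongrightarrow> t) (at_right 0)"
    by (auto intro!: tendsto_eq_intros)
  ultimately have "((\<lambda>a. delta_kernel c (t - a)) \<longlongrightarrow> delta_kernel c t) (at_right 0)"
    by (rule isCont_tendsto_compose)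
  from tendsto_mult[OF delta_kernel_tendsto_1[OF c] this] show ?thesis by simp
qed

text \<open>Limit \<open>a \<longrightarrow> 0\<close> of the majorization inequality for the pairs \<open>(a, t - a)\<close> and \<open>(u, t - u)\<close>.\<close>
lemma delta_kernel_le_mult:
  assumes c: "0 < c" "c \<le> 1" and u: "0 < u" "u < t"
  shows "delta_kernel c t \<le> delta_kernel c u * delta_kernel c (t - u)"
proof (rule tendsto_upperbound[OF delta_kernel_mult_tendsto])
  have "eventually (\<lambda>a. a < min u (t - u)) (at_right 0)"
    using u by (intro eventually_at_right_real[of 0 "min u (t - u)", THEN eventually_mono]) auto
  with eventually_at_right_less[of 0]
  show "eventually (\<lambda>a. delta_kernel c a * delta_kernel c (t - a) \<le> delta_kernel c u * delta_kernel c (t - u)) (at_right 0)"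
    by eventually_elim (use c u in \<open>auto intro!: delta_kernel_majorization_concave\<close>)
qed (use assms in auto)

lemma delta_kernel_ge_mult:
  assumes c: "c \<ge> 1" and u: "0 < u" "u < t"
  shows "delta_kernel c t \<ge> delta_kernel c u * delta_kernel c (t - u)"
proof (rule tendsto_lowerbound[OF delta_kernel_mult_tendsto])
  have "eventually (\<lambda>a. a < min u (t - u)) (at_right 0)"
    using u by (intro eventually_at_right_real[of 0 "min u (t - u)", THEN eventually_mono]) auto
  with eventually_at_right_less[of 0]
  show "eventually (\<lambda>a. delta_kernel c a * delta_kernel c (t - a) \<ge> delta_kernel c u * delta_kernel c (t - u)) (at_right 0)"
    by eventually_elim (use c u in \<open>auto intro!: delta_kernel_majorization_convex\<close>)
qed (use assms in auto)

text \<open>The logarithmic derivative is \<open>dlog_one_minus_exp\<close> at \<open>c\<close>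
  minus its value at 1, which is nonnegative as \<open>c \<le> 1\<close>.\<close>

lemma delta_kernel_mono:
  assumes c: "0 < c" "c \<le> 1" and u: "0 < u" "u \<le> t"
  shows "delta_kernel c u \<le> delta_kernel c t"
proof -
  have "ln (delta_kernel c u) \<le> ln (delta_kernel c t)"
  proof (rule DERIV_nonneg_imp_nondecreasing[OF u(2)])
    fix y assume y: "u \<le> y" "y \<le> t"
    show "\<exists>d. ((\<lambda>y. ln (delta_kernel c y)) has_real_derivative d) (at y) \<and> 0 \<le> d"
      using ln_delta_kernel_deriv[of c y] dlog_one_minus_exp_antimono[of c 1 y] c u y
      by (intro exI[of _ "dlog_one_minus_exp c y - dlog_one_minus_exp 1 y"]) auto
  qed
  thus ?thesis using c u delta_kernel_pos[of c u] delta_kernel_pos[of c t] by simp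
qed

lemma delta_kernel_antimono:
  assumes c: "c \<ge> 1" and u: "0 < u" "u \<le> t"
  shows "delta_kernel c t \<le> delta_kernel c u"
proof -
  have "ln (delta_kernel c t) \<le> ln (delta_kernel c u)"
  proof (rule DERIV_nonpos_imp_nonincreasing[OF u(2)])
    fix y assume y: "u \<le> y" "y \<le> t"
    show "\<exists>d. ((\<lambda>y. ln (delta_kernel c y)) has_real_derivative d) (at y) \<and> d \<le> 0"
      using ln_delta_kernel_deriv[of c y] dlog_one_minus_exp_antimono[of 1 c y] c u y
      by (intro exI[of _ "dlog_one_minus_exp c y - dlog_one_minus_exp 1 y"]) auto
  qed
  thus ?thesis using c u delta_kernel_pos[of c u] delta_kernel_pos[of c t] by simp
qed

text \<open>The bound is the limit of the kernel at infinity, so it cannot be improved.\<close>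

lemma delta_kernel_le_inverse:
  assumes "0 < c" "c \<le> 1" "t > 0"
  shows "delta_kernel c t \<le> 1 / c"
proof -
  have "c * t \<le> 1 * t" using assms by (intro mult_right_mono) auto
  hence "(1 - exp (- c * t)) / (1 - exp (- t)) \<le> 1"
    using assms by (subst divide_le_eq_1_pos) auto
  hence "(1 - exp (- c * t)) / (1 - exp (- t)) / c \<le> 1 / c"
    using assms by (intro divide_right_mono) auto
  thus ?thesis by (simp add: delta_kernel_def mult.commute)
qed

lemma delta_kernel_ge_inverse:
  assumes "c \<ge> 1" "t > 0"
  shows "delta_kernel c t \<ge> 1 / c"
proof -
  have "1 * t \<le> c * t" using assms by (intro mult_right_mono) auto
  hence "(1 - exp (- c * t)) / (1 - exp (- t)) \<ge> 1"
    using assms by (subst le_divide_eq_1_pos) auto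
  hence "(1 - exp (- c * t)) / (1 - exp (- t)) / c \<ge> 1 / c"
    using assms by (intro divide_right_mono) auto
  thus ?thesis by (simp add: delta_kernel_def mult.commute)
qed

text \<open>The first factor is bounded by the limit \<open>1 / c\<close> at infinity, the second by
  monotonicity since \<open>t - u \<le> t\<close>.\<close>

lemma delta_kernel_mult_le:
  assumes "0 < c" "c \<le> 1" "0 < u" "u < t"
  shows "delta_kernel c u * delta_kernel c (t - u) \<le> 1 / c * delta_kernel c t"
  using assms by (intro mult_mono delta_kernel_le_inverse delta_kernel_mono) (auto simp: less_imp_le delta_kernel_pos)

lemma delta_kernel_mult_ge:
  assumes "c \<ge> 1" "0 < u" "u < t"
  shows "1 / c * delta_kernel c t \<le> delta_kernel c u * delta_kernel c (t - u)"
  using assms by (intro mult_mono delta_kernel_ge_inverse delta_kernel_antimono) (auto simp: less_imp_le delta_kernel_pos)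

section \<open>Bounding a convolution by a single power, for the case \<open>q = 0\<close>\<close>

lemma nn_integral_Beta_const:
  assumes "t > 0" "C \<ge> 0"
  shows "(\<integral>\<^sup>+u\<in>{0<..<t}. ennreal (C * (u ^ a * (t - u) ^ b)) \<partial>lborel) =
     ennreal (fact a * fact b / fact (a + b + 1) * (C * t ^ (a + b + 1)))"
proof -
  have "(\<integral>\<^sup>+u\<in>{0<..<t}. ennreal (C * (u ^ a * (t - u) ^ b)) \<partial>lborel) =
      (\<integral>\<^sup>+u. ennreal C * (ennreal (u ^ a * (t - u) ^ b) * indicator {0<..<t} u) \<partial>lborel)"
    using assms by (intro nn_integral_cong) (auto simp: indicator_def ennreal_mult')
  also have "\<dots> = ennreal C * ennreal (fact a * fact b / fact (a + b + 1) * t ^ (a + b + 1))"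
    unfolding nn_integral_Beta_nat[OF assms(1), symmetric] by (rule nn_integral_cmult) measurable
  also have "\<dots> = ennreal (C * (fact a * fact b / fact (a + b + 1) * t ^ (a + b + 1)))"
    using assms by (intro ennreal_mult'[symmetric])
  finally show ?thesis by (simp add: mult.left_commute)
qed

lemma half_line_conv_delta_kernel_le:
  assumes t: "t > 0" and c: "c > 0" and C: "\<And>u. 0 < u \<Longrightarrow> u < t \<Longrightarrow> delta_kernel c u * delta_kernel c (t - u) \<le> C"
  shows "half_line_conv (\<lambda>u. ennreal (u ^ a * delta_kernel c u)) (\<lambda>u. ennreal (u ^ b * delta_kernel c u)) t \<le>
     ennreal (fact a * fact b / fact (a + b + 1) * (C * t ^ (a + b + 1)))"
proof -
  \<comment> \<open>The midpoint is a sample value that forces \<open>C\<close> to be nonnegative,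
    as \<open>nn_integral_Beta_const\<close> requires.\<close>
  have "0 < delta_kernel c (t / 2) * delta_kernel c (t - t / 2)"
    using t c by (intro mult_pos_pos delta_kernel_pos) auto
  also have "\<dots> \<le> C" using t by (intro C) auto
  finally have "C \<ge> 0" by simp
  show ?thesis
    unfolding half_line_conv_def nn_integral_Beta_const[OF t \<open>C \<ge> 0\<close>, symmetric]
  proof (rule nn_integral_mono)
    fix u
    show "ennreal (u ^ a * delta_kernel c u) * ennreal ((t - u) ^ b * delta_kernel c (t - u)) * indicator {0<..<t} u \<le>
        ennreal (C * (u ^ a * (t - u) ^ b)) * indicator {0<..<t} u"
    proof (cases "u \<in> {0<..<t}")
      case True
      hence "(delta_kernel c u * delta_kernel c (t - u)) * (u ^ a * (t - u) ^ b) \<le> C * (u ^ a * (t - u) ^ b)"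
        by (intro mult_right_mono C) auto
      hence "(u ^ a * delta_kernel c u) * ((t - u) ^ b * delta_kernel c (t - u)) \<le> C * (u ^ a * (t - u) ^ b)"
        by (simp only: mult_ac)
      hence "ennreal ((u ^ a * delta_kernel c u) * ((t - u) ^ b * delta_kernel c (t - u))) \<le> ennreal (C * (u ^ a * (t - u) ^ b))"
        by (rule ennreal_leI)
      thus ?thesis using True delta_kernel_pos[OF c, of u] by (simp add: ennreal_mult')
    qed auto
  qed
qed

lemma half_line_conv_delta_kernel_ge:
  assumes t: "t > 0" and c: "c > 0" and C: "\<And>u. 0 < u \<Longrightarrow> u < t \<Longrightarrow> delta_kernel c u * delta_kernel c (t - u) \<ge> C" and "C \<ge> 0"
  shows "half_line_conv (\<lambda>u. ennreal (u ^ a * delta_kernel c u)) (\<lambda>u. ennreal (u ^ b * delta_kernel c u)) t \<ge>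
     ennreal (fact a * fact b / fact (a + b + 1) * (C * t ^ (a + b + 1)))"
  unfolding half_line_conv_def nn_integral_Beta_const[OF t \<open>C \<ge> 0\<close>, symmetric]
proof (rule nn_integral_mono)
  fix u
  show "ennreal (u ^ a * delta_kernel c u) * ennreal ((t - u) ^ b * delta_kernel c (t - u)) * indicator {0<..<t} u \<ge>
      ennreal (C * (u ^ a * (t - u) ^ b)) * indicator {0<..<t} u"
  proof (cases "u \<in> {0<..<t}")
    case True
    hence "(delta_kernel c u * delta_kernel c (t - u)) * (u ^ a * (t - u) ^ b) \<ge> C * (u ^ a * (t - u) ^ b)"
      by (intro mult_right_mono C) auto
    hence "(u ^ a * delta_kernel c u) * ((t - u) ^ b * delta_kernel c (t - u)) \<ge> C * (u ^ a * (t - u) ^ b)"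
      by (simp only: mult_ac)
    hence "ennreal ((u ^ a * delta_kernel c u) * ((t - u) ^ b * delta_kernel c (t - u))) \<ge> ennreal (C * (u ^ a * (t - u) ^ b))"
      by (rule ennreal_leI)
    thus ?thesis using True delta_kernel_pos[OF c, of u] by (simp add: ennreal_mult')
  qed auto
qed

text \<open>Represents \<open>delta_psi c m\<close> for \<open>m \<ge> 1\<close> only. The constant
  function of index 0 is the transform of a unit mass at 0, which has no density; hence
  \<open>q = 0\<close> is treated separately, with one kernel in place of a convolution.\<close>

definition power_kernel :: "real \<Rightarrow> nat \<Rightarrow> real \<Rightarrow> ennreal" where
  "power_kernel c m t = ennreal (t ^ (m - 1) * delta_kernel c t)"

lemma laplace_seq_power_kernel:
  assumes "c > 0" "m \<ge> 1"
  shows "laplace_seq (\<lambda>k. delta_psi c (m + k)) (power_kernel c m)"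
  using laplace_seq_delta_psi[of c "m - 1"] assms by (simp add: power_kernel_def[abs_def])

lemma completely_monotonic_F_from_kernels:
  assumes c: "c > 0" and pos: "m \<ge> 1" "n \<ge> 1" "p \<ge> 1" "q \<ge> 1" and s0: "s0 > 0"
  shows "(\<And>t. t > 0 \<Longrightarrow> ennreal s0 * half_line_conv (power_kernel c p) (power_kernel c q) t \<le> half_line_conv (power_kernel c m) (power_kernel c n) t)
      \<Longrightarrow> s \<le> s0 \<Longrightarrow> completely_monotonic_on {0<..} (\<lambda>x. F p m n q x s c)"
    and "(\<And>t. t > 0 \<Longrightarrow> half_line_conv (power_kernel c m) (power_kernel c n) t \<le> ennreal s0 * half_line_conv (power_kernel c p) (power_kernel c q) t)
      \<Longrightarrow> s \<ge> s0 \<Longrightarrow> completely_monotonic_on {0<..} (\<lambda>x. - F p m n q x s c)"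
proof -
  note seqs = laplace_seq_mult[OF laplace_seq_power_kernel[OF c pos(1)] laplace_seq_power_kernel[OF c pos(2)]]
    laplace_seq_mult[OF laplace_seq_power_kernel[OF c pos(3)] laplace_seq_power_kernel[OF c pos(4)]]
  show "completely_monotonic_on {0<..} (\<lambda>x. F p m n q x s c)"
    if "\<And>t. t > 0 \<Longrightarrow> ennreal s0 * half_line_conv (power_kernel c p) (power_kernel c q) t \<le> half_line_conv (power_kernel c m) (power_kernel c n) t" "s \<le> s0"
    using completely_monotonic_laplace_diff[OF seqs _ that(2,1)] s0 by (simp add: F_eq_delta_psi)
  show "completely_monotonic_on {0<..} (\<lambda>x. - F p m n q x s c)"
    if "\<And>t. t > 0 \<Longrightarrow> half_line_conv (power_kernel c m) (power_kernel c n) t \<le> ennreal s0 * half_line_conv (power_kernel c p) (power_kernel c q) t" "s \<ge> s0"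
    using completely_monotonic_laplace_diff'[OF seqs s0 that(2,1)] by (simp add: F_eq_delta_psi)
qed

lemma completely_monotonic_F0_from_kernels:
  assumes c: "c > 0" and pos: "m \<ge> 1" "n \<ge> 1" and s0: "s0 > 0"
  shows "(\<And>t. t > 0 \<Longrightarrow> ennreal s0 * power_kernel c (m + n) t \<le> half_line_conv (power_kernel c m) (power_kernel c n) t)
      \<Longrightarrow> s \<le> s0 \<Longrightarrow> completely_monotonic_on {0<..} (\<lambda>x. F (m + n) m n 0 x s c)"
    and "(\<And>t. t > 0 \<Longrightarrow> half_line_conv (power_kernel c m) (power_kernel c n) t \<le> ennreal s0 * power_kernel c (m + n) t)
      \<Longrightarrow> s \<ge> s0 \<Longrightarrow> completely_monotonic_on {0<..} (\<lambda>x. - F (m + n) m n 0 x s c)"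
proof -
  have "m + n \<ge> 1" using pos by simp
  note seqs = laplace_seq_mult[OF laplace_seq_power_kernel[OF c pos(1)] laplace_seq_power_kernel[OF c pos(2)]] laplace_seq_power_kernel[OF c this]
  show "completely_monotonic_on {0<..} (\<lambda>x. F (m + n) m n 0 x s c)"
    if "\<And>t. t > 0 \<Longrightarrow> ennreal s0 * power_kernel c (m + n) t \<le> half_line_conv (power_kernel c m) (power_kernel c n) t" "s \<le> s0"
    using completely_monotonic_laplace_diff[OF seqs _ that(2,1)] s0 c by (simp add: F_eq_delta_psi delta_psi_0)
  show "completely_monotonic_on {0<..} (\<lambda>x. - F (m + n) m n 0 x s c)"
    if "\<And>t. t > 0 \<Longrightarrow> half_line_conv (power_kernel c m) (power_kernel c n) t \<le> ennreal s0 * power_kernel c (m + n) t" "s \<ge> s0"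
    using completely_monotonic_laplace_diff'[OF seqs s0 that(2,1)] c by (simp add: F_eq_delta_psi delta_psi_0)
qed

text \<open>The factor \<open>K\<close> serves both thresholds: \<open>K = 1\<close> leads to
  \<open>alpha\<close>, \<open>K = 1 / c\<close> to \<open>alpha / c\<close>. The remaining Beta
  factor is \<open>alpha\<close> itself.\<close>

lemma power_kernel_conv_le:
  assumes t: "t > 0" and c: "c > 0" and K: "K \<ge> 0" and pos: "m \<ge> 1" "n \<ge> 1"
    and C: "\<And>u. 0 < u \<Longrightarrow> u < t \<Longrightarrow> delta_kernel c u * delta_kernel c (t - u) \<le> K * delta_kernel c t"
  shows "half_line_conv (power_kernel c m) (power_kernel c n) t \<le> ennreal (K * alpha (m + n) m n 0) * power_kernel c (m + n) t"
proof -
  have e: "m - 1 + (n - 1) + 1 = m + n - 1" using pos by simp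
  have "half_line_conv (power_kernel c m) (power_kernel c n) t \<le>
     ennreal (fact (m - 1) * fact (n - 1) / fact (m - 1 + (n - 1) + 1) * (K * delta_kernel c t * t ^ (m - 1 + (n - 1) + 1)))"
    unfolding power_kernel_def[abs_def] by (rule half_line_conv_delta_kernel_le[OF t c C])
  also have "\<dots> = ennreal (K * alpha (m + n) m n 0 * (t ^ (m + n - 1) * delta_kernel c t))"
    unfolding e by (simp add: alpha_eq mult_ac)
  also have "\<dots> = ennreal (K * alpha (m + n) m n 0) * power_kernel c (m + n) t"
    unfolding power_kernel_def using K alpha_pos[of "m + n" m n 0] by (intro ennreal_mult') simp
  finally show ?thesis .
qed

lemma power_kernel_conv_ge:
  assumes t: "t > 0" and c: "c > 0" and K: "K \<ge> 0" and pos: "m \<ge> 1" "n \<ge> 1"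
    and C: "\<And>u. 0 < u \<Longrightarrow> u < t \<Longrightarrow> delta_kernel c u * delta_kernel c (t - u) \<ge> K * delta_kernel c t"
  shows "half_line_conv (power_kernel c m) (power_kernel c n) t \<ge> ennreal (K * alpha (m + n) m n 0) * power_kernel c (m + n) t"
proof -
  have e: "m - 1 + (n - 1) + 1 = m + n - 1" using pos by simp
  have "ennreal (K * alpha (m + n) m n 0) * power_kernel c (m + n) t =
    ennreal (K * alpha (m + n) m n 0 * (t ^ (m + n - 1) * delta_kernel c t))"
    unfolding power_kernel_def using K alpha_pos[of "m + n" m n 0] by (intro ennreal_mult'[symmetric]) simp
  also have "\<dots> = ennreal (fact (m - 1) * fact (n - 1) / fact (m - 1 + (n - 1) + 1) * (K * delta_kernel c t * t ^ (m - 1 + (n - 1) + 1)))"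
    unfolding e by (simp add: alpha_eq mult_ac)
  also have "\<dots> \<le> half_line_conv (power_kernel c m) (power_kernel c n) t"
    unfolding power_kernel_def[abs_def] using K delta_kernel_pos[OF c t] by (intro half_line_conv_delta_kernel_ge[OF t c C]) auto
  finally show ?thesis .
qed

text \<open>Moves one power of \<open>t\<close> between monomial and weight. The exponents become
  \<open>p\<close> instead of \<open>p - 1\<close>, so the comparison produces \<open>beta\<close>
  in place of \<open>alpha\<close>.\<close>

lemma power_kernel_shift: "p \<ge> 1 \<Longrightarrow> u > 0 \<Longrightarrow> power_kernel c p u = ennreal (u ^ p * (delta_kernel c u / u))"
  by (cases p) (auto simp: power_kernel_def)

lemma half_line_conv_cong:
  assumes "\<And>u. u > 0 \<Longrightarrow> K u = K' u" "\<And>u. u > 0 \<Longrightarrow> L u = L' u"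
  shows "half_line_conv K L t = half_line_conv K' L' t"
  unfolding half_line_conv_def using assms by (intro nn_integral_cong) (auto simp: indicator_def)

section \<open>Sharp thresholds, and complete monotonicity at the constant \<beta>\<close>

lemma completely_monotonic_F_iff:
  assumes pmnq: "p > m" "m \<ge> n" "n > q" "m + n = p + q" and c: "0 < c" "c \<le> 1"
  shows "completely_monotonic_on {0<..} (\<lambda>x. F p m n q x s c) \<longleftrightarrow> s \<le> alpha p m n q"
proof
  assume "completely_monotonic_on {0<..} (\<lambda>x. F p m n q x s c)"
  thus "s \<le> alpha p m n q"
    by (intro F_nonneg_imp_le_alpha[OF c(1) pmnq(4)]) (auto dest: completely_monotonic_on_nonneg)
next
  assume s: "s \<le> alpha p m n q"
  show "completely_monotonic_on {0<..} (\<lambda>x. F p m n q x s c)"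
  proof (cases "q = 0")
    case True
    have p: "p = m + n" and mn: "m \<ge> 1" "n \<ge> 1" using True pmnq by simp_all
    show ?thesis unfolding True p
    proof (rule completely_monotonic_F0_from_kernels(1)[OF c(1) mn alpha_pos _ s[unfolded True p]])
      show "ennreal (alpha (m + n) m n 0) * power_kernel c (m + n) t \<le> half_line_conv (power_kernel c m) (power_kernel c n) t" if "t > 0" for t
        using power_kernel_conv_ge[OF that c(1) _ mn, of 1] delta_kernel_le_mult[OF c] by simp
    qed
  next
    case False
    show ?thesis
    proof (rule completely_monotonic_F_from_kernels(1)[OF c(1) _ _ _ _ alpha_pos[of p m n q]])
      \<comment> \<open>The weight comparison is used with all four exponents lowered by one, which
        keeps the two sums equal because \<open>q \<ge> 1\<close> and turns its factorial quotient
        into \<open>alpha\<close>.\<close>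
      show "ennreal (alpha p m n q) * half_line_conv (power_kernel c p) (power_kernel c q) t \<le> half_line_conv (power_kernel c m) (power_kernel c n) t" if "t > 0" for t
        unfolding power_kernel_def[abs_def] alpha_eq
        by (rule half_line_conv_power_weight_ge[OF delta_kernel_measurable _ _ _ _ _ that delta_kernel_majorization_concave[OF c]])
           (use pmnq False c in \<open>simp_all add: less_imp_le delta_kernel_pos\<close>)
    qed (use s pmnq False in auto)
  qed
qed

lemma completely_monotonic_minus_F_iff:
  assumes pmnq: "p > m" "m \<ge> n" "n > q" "m + n = p + q" and c: "c \<ge> 1"
  shows "completely_monotonic_on {0<..} (\<lambda>x. - F p m n q x s c) \<longleftrightarrow> s \<ge> alpha p m n q"
proof
  have c0: "c > 0" using c by simp
  {
    assume "completely_monotonic_on {0<..} (\<lambda>x. - F p m n q x s c)"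
    thus "s \<ge> alpha p m n q"
      by (intro F_nonpos_imp_ge_alpha[OF c0 pmnq(4)]) (auto dest: completely_monotonic_on_nonneg)
  next
    assume s: "s \<ge> alpha p m n q"
    show "completely_monotonic_on {0<..} (\<lambda>x. - F p m n q x s c)"
    proof (cases "q = 0")
      case True
      have p: "p = m + n" and mn: "m \<ge> 1" "n \<ge> 1" using True pmnq by simp_all
      show ?thesis unfolding True p
      proof (rule completely_monotonic_F0_from_kernels(2)[OF c0 mn alpha_pos _ s[unfolded True p]])
        show "half_line_conv (power_kernel c m) (power_kernel c n) t \<le> ennreal (alpha (m + n) m n 0) * power_kernel c (m + n) t" if "t > 0" for t
          using power_kernel_conv_le[OF that c0 _ mn, of 1] delta_kernel_ge_mult[OF c] by simp
      qed
    next
      case False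
      show ?thesis
      proof (rule completely_monotonic_F_from_kernels(2)[OF c0 _ _ _ _ alpha_pos[of p m n q]])
        show "half_line_conv (power_kernel c m) (power_kernel c n) t \<le> ennreal (alpha p m n q) * half_line_conv (power_kernel c p) (power_kernel c q) t" if "t > 0" for t
          unfolding power_kernel_def[abs_def] alpha_eq
          by (rule half_line_conv_power_weight_le[OF delta_kernel_measurable _ _ _ _ _ that delta_kernel_majorization_convex[OF c]])
             (use pmnq False c in \<open>simp_all add: less_imp_le delta_kernel_pos\<close>)
      qed (use s pmnq False in auto)
    qed
  }
qed

lemma completely_monotonic_minus_F0_iff:
  assumes mn: "m \<ge> 1" "n \<ge> 1" and c: "0 < c" "c \<le> 1"
  shows "completely_monotonic_on {0<..} (\<lambda>x. - F (m + n) m n 0 x s c) \<longleftrightarrow> s \<ge> alpha (m + n) m n 0 / c"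
proof
  assume "completely_monotonic_on {0<..} (\<lambda>x. - F (m + n) m n 0 x s c)"
  thus "s \<ge> alpha (m + n) m n 0 / c"
    by (intro F0_nonpos_imp_ge_alpha[OF c(1) mn]) (auto dest: completely_monotonic_on_nonneg)
next
  assume s: "s \<ge> alpha (m + n) m n 0 / c"
  show "completely_monotonic_on {0<..} (\<lambda>x. - F (m + n) m n 0 x s c)"
  proof (rule completely_monotonic_F0_from_kernels(2)[OF c(1) mn _ _ s])
    show "half_line_conv (power_kernel c m) (power_kernel c n) t \<le> ennreal (alpha (m + n) m n 0 / c) * power_kernel c (m + n) t" if "t > 0" for t
      using power_kernel_conv_le[OF that c(1) _ mn delta_kernel_mult_le[OF c]] c by simp
  qed (use c alpha_pos[of "m + n" m n 0] in auto)
qed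

lemma completely_monotonic_F0_iff:
  assumes mn: "m \<ge> 1" "n \<ge> 1" and c: "c \<ge> 1"
  shows "completely_monotonic_on {0<..} (\<lambda>x. F (m + n) m n 0 x s c) \<longleftrightarrow> s \<le> alpha (m + n) m n 0 / c"
proof
  have c0: "c > 0" using c by simp
  {
    assume "completely_monotonic_on {0<..} (\<lambda>x. F (m + n) m n 0 x s c)"
    thus "s \<le> alpha (m + n) m n 0 / c"
      by (intro F0_nonneg_imp_le_alpha[OF c0 mn]) (auto dest: completely_monotonic_on_nonneg)
  next
    assume s: "s \<le> alpha (m + n) m n 0 / c"
    show "completely_monotonic_on {0<..} (\<lambda>x. F (m + n) m n 0 x s c)"
    proof (rule completely_monotonic_F0_from_kernels(1)[OF c0 mn _ _ s])
      show "ennreal (alpha (m + n) m n 0 / c) * power_kernel c (m + n) t \<le> half_line_conv (power_kernel c m) (power_kernel c n) t" if "t > 0" for t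
        using power_kernel_conv_ge[OF that c0 _ mn delta_kernel_mult_ge[OF c]] c by simp
    qed (use c alpha_pos[of "m + n" m n 0] in auto)
  }
qed

text \<open>Same comparison as for \<open>c \<ge> 1\<close>, but with the weight
  \<open>delta_kernel c u / u\<close> and unshifted exponents; the log-convexity of this weight does
  not depend on the size of \<open>c\<close>.\<close>

lemma completely_monotonic_minus_F_beta:
  assumes pmnq: "p > m" "m \<ge> n" "n > q" "m + n = p + q" and q: "q \<ge> 1" and c: "c > 0"
  shows "completely_monotonic_on {0<..} (\<lambda>x. - F p m n q x (beta p m n q) c)"
proof (rule completely_monotonic_F_from_kernels(2)[OF c])
  fix t :: real
  assume t: "t > 0"
  have eq: "half_line_conv (power_kernel c i) (power_kernel c j) t = half_line_conv (\<lambda>u. ennreal (u ^ i * (delta_kernel c u / u))) (\<lambda>u. ennreal (u ^ j * (delta_kernel c u / u))) t"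
    if "i \<ge> 1" "j \<ge> 1" for i j
    using that by (intro half_line_conv_cong power_kernel_shift)
  have ge1: "m \<ge> 1" "n \<ge> 1" "p \<ge> 1" using pmnq by auto
  show "half_line_conv (power_kernel c m) (power_kernel c n) t \<le> ennreal (beta p m n q) * half_line_conv (power_kernel c p) (power_kernel c q) t"
    unfolding eq[OF ge1(1,2)] eq[OF ge1(3) q] beta_def
  proof (rule half_line_conv_power_weight_le[OF _ _ pmnq t])
    fix a b a' b' :: real
    assume "0 < a" "a \<le> a'" "a' \<le> b" "a + b = a' + b'"
    thus "delta_kernel c a' / a' * (delta_kernel c b' / b') \<le> delta_kernel c a / a * (delta_kernel c b / b)"
      by (intro majorization_from_ln[OF _ delta_kernel_over_id_log_convex[OF c]]) (simp_all add: c delta_kernel_pos)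
  qed (simp_all add: less_imp_le c delta_kernel_pos)
qed (use pmnq q in \<open>auto simp: beta_def\<close>)

theorem theorem1p2:
  fixes p m n q :: nat and c s :: real
  assumes "p > m" and "m \<ge> n" and "n > q"
    and "m + n = p + q"
    and "c > 0"
  shows
    "(0 < c \<and> c \<le> 1 \<longrightarrow>
        (completely_monotonic_on {0<..} (\<lambda>x. F p m n q x s c) \<longleftrightarrow> s \<le> alpha p m n q) \<and>
        (completely_monotonic_on {0<..} (\<lambda>x. - F (m + n) m n 0 x s c) \<longleftrightarrow>
           s \<ge> alpha (m + n) m n 0 / c)) \<and>
     (c \<ge> 1 \<longrightarrow>
        (completely_monotonic_on {0<..} (\<lambda>x. - F p m n q x s c) \<longleftrightarrow> s \<ge> alpha p m n q) \<and>
        (completely_monotonic_on {0<..} (\<lambda>x. F (m + n) m n 0 x s c) \<longleftrightarrow>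
           s \<le> alpha (m + n) m n 0 / c)) \<and>
     (q \<ge> 1 \<longrightarrow>
        (\<forall>d>0. completely_monotonic_on {0<..} (\<lambda>x. - F p m n q x (beta p m n q) d)))"
proof (intro conjI impI allI)
  have "m \<ge> 1" "n \<ge> 1" using assms by auto
  note iffs = completely_monotonic_F_iff[OF assms(1-4)] completely_monotonic_minus_F_iff[OF assms(1-4)]
    completely_monotonic_F0_iff[OF this] completely_monotonic_minus_F0_iff[OF this]
  show "completely_monotonic_on {0<..} (\<lambda>x. F p m n q x s c) \<longleftrightarrow> s \<le> alpha p m n q"
    and "completely_monotonic_on {0<..} (\<lambda>x. - F (m + n) m n 0 x s c) \<longleftrightarrow> s \<ge> alpha (m + n) m n 0 / c"
    if "0 < c \<and> c \<le> 1"
    using iffs that by blast+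
  show "completely_monotonic_on {0<..} (\<lambda>x. - F p m n q x s c) \<longleftrightarrow> s \<ge> alpha p m n q"
    and "completely_monotonic_on {0<..} (\<lambda>x. F (m + n) m n 0 x s c) \<longleftrightarrow> s \<le> alpha (m + n) m n 0 / c"
    if "c \<ge> 1"
    using iffs that by blast+
  show "completely_monotonic_on {0<..} (\<lambda>x. - F p m n q x (beta p m n q) d)" if "q \<ge> 1" "d > 0" for d
    using completely_monotonic_minus_F_beta[OF assms(1-4) that] .
qed

end
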